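(* Let $\gamma\in\mathbb{H}$ and let $X_1,X_2,\dots$ be i.i.d. Cauchy random variables with complex parameter $\gamma$. For $\alpha\in\overline{\mathbb{H}}$ and $0<p<1$ let $M^{f^{(\alpha)}_p}_n=\left(\frac1n\sum_{j=1}^n (X_j+\alpha)^p\right)^{1/p}-\alpha$, $M^{f^{(\alpha)}_1}_n=\frac1n\sum_{j=1}^n X_j$ and $G^{(\alpha)}_n=\prod_{j=1}^n (X_j+\alpha)^{1/n}-\alpha$. (i) Let $n\ge2$, $0<p<1$ and $\alpha\in\overline{\mathbb{H}}$. Then $n^{1/p}M^{f^{(\alpha)}_p}_n-nM^{f^{(\alpha)}_1}_n\in L^1$ and $$E\left[\frac{n^{1/p}M^{f^{(\alpha)}_p}_n-nM^{f^{(\alpha)}_1}_n}{n^{1/p}-n}\right]=\gamma.$$ (ii) Let $n\ge2$ and $\alpha\in\overline{\mathbb{H}}$. Then $$\lim_{p\to+0}\frac{n^{1/p}M^{f^{(\alpha)}_p}_n-nM^{f^{(\alpha)}_1}_n}{n^{1/p}-n}=G^{(\alpha)}_n\quad\text{almost surely and in }L^1.$$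
   Context: $\mathbb{H}=\{z\in\mathbb{C}:\mathrm{Im}(z)>0\}$ and $\overline{\mathbb{H}}=\{z\in\mathbb{C}:\mathrm{Im}(z)\ge0\}$. The Cauchy distribution with complex parameter $\gamma=\mu+i\sigma$, $\mu\in\mathbb{R}$, $\sigma>0$, has density $p_\gamma(x)=\frac{\sigma}{\pi}\frac{1}{(x-\mu)^2+\sigma^2}$ on $\mathbb{R}$. Complex powers use the principal branch: $z^q=\exp(q\log z)$ with $\log z=\log r+i\theta$ for $z=r e^{i\theta}$, $r>0$, $\theta\in(-\pi,\pi]$; $0^p=0$ for $0<p<1$. Here $f^{(\alpha)}_p(x)=(x+\alpha)^p$ and $M^f_n=f^{-1}(\frac1n\sum_{j=1}^n f(X_j))$. $Y\in L^1$ means $E[|Y|]<+\infty$, and $E[Y]=E[\mathrm{Re}(Y)]+iE[\mathrm{Im}(Y)]$. $p\to+0$ means $p\to 0$ with $p>0$. *)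

theory Defs
  imports "HOL-Probability.Probability"
begin

definition cauchy_density :: "complex \<Rightarrow> real \<Rightarrow> real" where
  "cauchy_density \<gamma> x = Im \<gamma> / pi * (1 / ((x - Re \<gamma>)\<^sup>2 + (Im \<gamma>)\<^sup>2))"

definition iid_cauchy :: "'a measure \<Rightarrow> (nat \<Rightarrow> 'a \<Rightarrow> real) \<Rightarrow> complex \<Rightarrow> bool" where
  "iid_cauchy M X \<gamma> \<longleftrightarrow>
     prob_space.indep_vars M (\<lambda>_. borel) X {1..} \<and>
     (\<forall>j\<ge>1. distributed M lborel (X j) (\<lambda>x. ennreal (cauchy_density \<gamma> x)))"

text \<open>Complex \<open>powr\<close> is the principal branch with argument in \<open>(-pi, pi]\<close>
  (so \<open>-1\<close> has argument \<open>pi\<close>), and \<open>0 powr w = 0\<close>. The means below are functions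
  of the data \<open>x 1, \<dots>, x n\<close>; the value \<open>x 0\<close> is never used.\<close>

definition power_mean :: "complex \<Rightarrow> real \<Rightarrow> nat \<Rightarrow> (nat \<Rightarrow> real) \<Rightarrow> complex" where
  "power_mean \<alpha> p n x =
     (1 / of_nat n * (\<Sum>j=1..n. (of_real (x j) + \<alpha>) powr of_real p)) powr of_real (1 / p) - \<alpha>"

definition arith_mean :: "nat \<Rightarrow> (nat \<Rightarrow> real) \<Rightarrow> complex" where
  "arith_mean n x = of_real (1 / real n * (\<Sum>j=1..n. x j))"

text \<open>The root is taken factor by factor, not of the product.\<close>

definition geom_mean :: "complex \<Rightarrow> nat \<Rightarrow> (nat \<Rightarrow> real) \<Rightarrow> complex" where
  "geom_mean \<alpha> n x = (\<Prod>j=1..n. (of_real (x j) + \<alpha>) powr of_real (1 / real n)) - \<alpha>"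

text \<open>Integrability is part of the notion, since the Bochner integral of a
  non-integrable function is \<open>0\<close>.\<close>

definition tendsto_L1 ::
  "'a measure \<Rightarrow> ('b \<Rightarrow> 'a \<Rightarrow> complex) \<Rightarrow> ('a \<Rightarrow> complex) \<Rightarrow> 'b filter \<Rightarrow> bool" where
  "tendsto_L1 M Y Z F \<longleftrightarrow>
     (\<forall>\<^sub>F p in F. integrable M (Y p)) \<and> integrable M Z \<and>
     ((\<lambda>p. \<integral>\<omega>. norm (Y p \<omega> - Z \<omega>) \<partial>M) \<longlongrightarrow> 0) F"

end

theory Submission
  imports Defs "HOL-Complex_Analysis.Complex_Analysis" "HOL-Real_Asymp.Real_Asymp"
begin

text \<open>
  Write \<open>z\<^sub>j = X\<^sub>j + \<alpha>\<close> and \<open>q = 1 / p\<close>. Expanding the two means, the numerator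
  \<open>n\<^sup>q M\<^sub>p - n M\<^sub>1\<close> equals \<open>F(z) - (n\<^sup>q - n) \<alpha>\<close>, where
  \<open>F(z) = (\<Sum> z\<^sub>j\<^sup>p)\<^sup>q - \<Sum> z\<^sub>j\<close> is called the power sum defect below
  (lemma \<open>power_arith_difference_eq\<close>).

  The expectation. The Cauchy density with parameter \<open>\<gamma>\<close> is the Poisson kernel of the upper
  half plane at \<open>\<gamma>\<close>, so integrating the boundary values of a holomorphic function of
  sublinear growth returns its value at \<open>\<gamma>\<close> (theorem \<open>Poisson_upper_half_plane\<close>). Since
  \<open>0 < p < 1\<close>, all the sums \<open>\<Sum> z\<^sub>j\<^sup>p\<close> stay in the closed upper half plane, where the
  principal power with positive exponent is continuous, negative axis included; hence \<open>F\<close> is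
  admissible in each variable separately. Replacing the variables by \<open>\<gamma>\<close> one after the other
  (theorem \<open>Poisson_product\<close>) gives
  \<open>E F = F(\<gamma> + \<alpha>, \<dots>, \<gamma> + \<alpha>) = (n\<^sup>q - n) (\<gamma> + \<alpha>)\<close>.

  Integrability. Neither term of \<open>F\<close> is integrable; their difference is, because if \<open>z\<^sub>m\<close> is
  the largest entry then \<open>(\<Sum> z\<^sub>j\<^sup>p)\<^sup>q\<close> and \<open>z\<^sub>m = (z\<^sub>m\<^sup>p)\<^sup>q\<close> differ by at most a constant
  times \<open>|z\<^sub>m|\<^bsup>1 - p\<^esup>\<close> times the sum of the other \<open>|z\<^sub>j|\<^sup>p\<close> (lemma
  \<open>norm_power_sum_defect_le\<close>).

  The limit. Pointwise, \<open>log ((1/n) \<Sum> z\<^sub>j\<^sup>p)\<close> vanishes at \<open>p = 0\<close> with derivative the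
  average of the \<open>log z\<^sub>j\<close>, so the power means tend to the geometric mean, while
  \<open>n\<^bsup>1 - q\<^esup>\<close> tends to 0. For convergence in \<open>L\<^sup>1\<close> one needs a majorant of \<open>n\<^bsup>-q\<^esup> |F|\<close>
  valid for all small \<open>p\<close>. A power \<open>|z|\<^sup>a\<close> with a fixed \<open>a < 1\<close> cannot serve, since the
  exponent \<open>1 - p\<close> tends to 1. The weight \<open>t / (2 + log t)\<^sup>2\<close> can: the Cauchy law integrates
  it, and it dominates \<open>p\<^sup>2 t\<^bsup>1 - p\<^esup>\<close> for all \<open>p\<close> at once (lemma
  \<open>powr_le_log_weight\<close>). The factor \<open>q\<^sup>2\<close> which this costs is paid for by exponential
  decay: if the largest of the numbers \<open>(1 + |z\<^sub>j|)\<^sup>p\<close> is more than twice every other one, their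
  mean is at most three quarters of it, and taking \<open>q\<close>-th powers gains a factor of order
  \<open>(3/4)\<^sup>q\<close>. Otherwise the two largest entries are comparable, and each contributes only a power
  with exponent \<open>3/4\<close> (lemma
  \<open>power_sum_defect_uniformly_dominated\<close>).
\<close>

section \<open>Powers on the closed upper half plane\<close>

lemma Im_powr_nonneg:
  assumes "0 \<le> Im z" "0 \<le> p" "p \<le> 1"
  shows "0 \<le> Im (z powr of_real p)"
proof (cases "z = 0")
  case False
  then have L: "0 \<le> Im (Ln z)" "Im (Ln z) \<le> pi"
    using Im_Ln_pos_le assms(1) by auto
  have "0 \<le> p * Im (Ln z)" "p * Im (Ln z) \<le> pi"
    using L assms mult_left_le_one_le[of "Im (Ln z)" p] by auto
  then show ?thesis
    using False by (simp add: powr_def Im_exp sin_ge_zero)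
qed auto

lemma Im_powr_pos:
  assumes "0 < Im z" "0 < p" "p \<le> 1"
  shows "0 < Im (z powr of_real p)"
proof -
  have z: "z \<noteq> 0" using assms by auto
  then have L: "0 < Im (Ln z)" "Im (Ln z) < pi"
    using Im_Ln_pos_lt assms(1) by auto
  have "0 < p * Im (Ln z)" "p * Im (Ln z) < pi"
    using L assms mult_left_le_one_le[of "Im (Ln z)" p] by (auto intro: le_less_trans[of _ "Im (Ln z)"])
  then show ?thesis
    using z by (simp add: powr_def Im_exp sin_gt_zero)
qed

text \<open>
  The principal argument of \<open>z\<close> lies in \<open>[0, \<pi>]\<close>, so multiplying it by \<open>p \<le> 1\<close> does not
  leave the principal range.
\<close>
lemma powr_powr_inverse:
  assumes "0 \<le> Im z" "0 < p" "p \<le> 1"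
  shows "(z powr of_real p) powr of_real (1 / p) = z"
proof (cases "z = 0")
  case False
  then have L: "0 \<le> Im (Ln z)" "Im (Ln z) \<le> pi"
    using Im_Ln_pos_le assms(1) by auto
  have "0 \<le> p * Im (Ln z)" "p * Im (Ln z) \<le> pi"
    using L assms mult_left_le_one_le[of "Im (Ln z)" p] by auto
  then have "Ln (z powr of_real p) = of_real p * Ln z"
    using False pi_gt_zero
    by (subst powr_def, subst if_not_P[OF False], intro Ln_exp) (auto intro: less_le_trans[of "- pi" 0])
  then show ?thesis
    using False assms by (simp add: powr_def)
qed auto

text \<open>
  Multiplication by \<open>- \<i>\<close> maps the closed upper half plane to the closed right half plane,
  which does not meet the branch cut. This turns regularity of principal powers up to the
  negative real axis, approached from above, into regularity away from the cut.
\<close>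
lemma powr_eq_rotated_powr:
  assumes "0 \<le> Im z"
  shows "z powr a = (- \<i> * z) powr a * exp (\<i> * of_real pi / 2 * a)"
proof (cases "z = 0")
  case False
  define y where "y = - \<i> * z"
  have y: "y \<noteq> 0" "0 \<le> Re y" "z = \<i> * y"
    using False assms by (auto simp: y_def)
  have "Ln z = Ln y + \<i> * of_real pi / 2"
    using Ln_times_ii[of y] y by simp
  then show ?thesis
    unfolding y_def[symmetric] using y False by (simp add: powr_def exp_add [symmetric] algebra_simps)
qed auto

lemma continuous_on_powr_upper:
  assumes "0 < a"
  shows "continuous_on {z. 0 \<le> Im z} (\<lambda>z. z powr of_real a)"
proof (subst continuous_on_cong[OF refl])
  show "z powr of_real a = (- \<i> * z) powr of_real a * exp (\<i> * of_real pi / 2 * of_real a)"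
    if "z \<in> {z. 0 \<le> Im z}" for z
    using that powr_eq_rotated_powr by simp
  show "continuous_on {z. 0 \<le> Im z}
      (\<lambda>z. (- \<i> * z) powr of_real a * exp (\<i> * of_real pi / 2 * of_real a))"
    using assms by (intro continuous_on_mult continuous_on_powr_complex continuous_intros) auto
qed

lemma norm_powr_of_real: "norm (z powr complex_of_real a) = norm z powr a"
  by (simp add: norm_powr_real_powr')

lemma norm_powr_diff_le_open:
  assumes "0 < Im a" "0 < Im b" "norm a \<le> \<rho>" "norm b \<le> \<rho>" "1 \<le> q"
  shows "norm (a powr of_real q - b powr of_real q) \<le> q * \<rho> powr (q - 1) * norm (a - b)"
proof (rule field_differentiable_bound[where S = "{z. 0 < Im z} \<inter> cball 0 \<rho>"])
  fix z :: complex
  assume z: "z \<in> {z. 0 < Im z} \<inter> cball 0 \<rho>"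
  then have "z \<notin> \<real>\<^sub>\<le>\<^sub>0"
    by (auto simp: complex_nonpos_Reals_iff)
  then show "((\<lambda>z. z powr of_real q) has_field_derivative of_real q * z powr (of_real q - 1))
      (at z within {z. 0 < Im z} \<inter> cball 0 \<rho>)"
    by (rule has_field_derivative_at_within[OF has_field_derivative_powr])
  have "norm (z powr (of_real q - 1)) = norm z powr (q - 1)"
    using norm_powr_of_real[of z "q - 1"] by simp
  also have "\<dots> \<le> \<rho> powr (q - 1)"
    using z assms by (intro powr_mono2) auto
  finally show "norm (of_real q * z powr (of_real q - 1)) \<le> q * \<rho> powr (q - 1)"
    using assms by (simp add: norm_mult mult_left_mono)
qed (use assms in \<open>auto intro!: convex_Int convex_halfspace_Im_gt\<close>)

text \<open>
  The mean value estimate for \<open>z\<^sup>q\<close>. Its derivative is only at hand off the branch cut, so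
  the boundary case is the limit of the estimate for points shifted upwards.
\<close>
lemma norm_powr_diff_le:
  assumes "0 \<le> Im a" "0 \<le> Im b" "norm a \<le> \<rho>" "norm b \<le> \<rho>" "1 \<le> q" "0 < \<rho>"
  shows "norm (a powr of_real q - b powr of_real q) \<le> q * \<rho> powr (q - 1) * norm (a - b)"
proof (rule tendsto_le[OF trivial_limit_at_right_real[of 0]])
  have shift: "((\<lambda>e::real. (z + \<i> * of_real e) powr of_real q) \<longlongrightarrow> z powr of_real q) (at_right 0)"
    if "0 \<le> Im z" for z
  proof -
    have "continuous_on {0..} (\<lambda>e::real. (z + \<i> * of_real e) powr of_real q)"
      using that assms
      by (intro continuous_on_compose2[OF continuous_on_powr_upper[of q]] continuous_intros) auto
    then have "((\<lambda>e::real. (z + \<i> * of_real e) powr of_real q) \<longlongrightarrow> z powr of_real q) (at 0 within {0..})"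
      by (auto simp: continuous_on_def dest!: bspec[where x = 0])
    then show ?thesis
      by (rule tendsto_within_subset) auto
  qed
  show "((\<lambda>e::real. norm ((a + \<i> * of_real e) powr of_real q - (b + \<i> * of_real e) powr of_real q))
      \<longlongrightarrow> norm (a powr of_real q - b powr of_real q)) (at_right 0)"
    using assms by (intro tendsto_intros shift) auto
  have "((\<lambda>e::real. q * (\<rho> + e) powr (q - 1) * norm (a - b)) \<longlongrightarrow>
      q * (\<rho> + 0) powr (q - 1) * norm (a - b)) (at_right 0)"
    using assms by (intro tendsto_intros) auto
  then show "((\<lambda>e::real. q * (\<rho> + e) powr (q - 1) * norm (a - b)) \<longlongrightarrow>
      q * \<rho> powr (q - 1) * norm (a - b)) (at_right 0)"
    by simp
  show "\<forall>\<^sub>F e in at_right 0.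
      norm ((a + \<i> * of_real e) powr of_real q - (b + \<i> * of_real e) powr of_real q)
        \<le> q * (\<rho> + e) powr (q - 1) * norm (a - b)"
    using eventually_at_right_less[of 0]
  proof eventually_elim
    case (elim e)
    have "norm (a + \<i> * of_real e) \<le> \<rho> + e" "norm (b + \<i> * of_real e) \<le> \<rho> + e"
      using assms elim norm_triangle_ineq[of a "\<i> * of_real e"] norm_triangle_ineq[of b "\<i> * of_real e"]
      by (simp_all add: norm_mult)
    then show ?case
      using norm_powr_diff_le_open[of "a + \<i> * of_real e" "b + \<i> * of_real e" "\<rho> + e" q] assms elim
      by simp
  qed
qed

section \<open>The Poisson integral for the upper half plane\<close>

text \<open>
  The factorisation that makes the density a Poisson kernel: as a function of a complex variable
  it has one simple pole in each half plane, at \<open>\<gamma>\<close> and at its conjugate.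
\<close>
lemma cauchy_density_eq:
  "complex_of_real (cauchy_density \<gamma> x) = of_real (Im \<gamma> / pi) / ((of_real x - \<gamma>) * (of_real x - cnj \<gamma>))"
proof -
  have "(of_real x - \<gamma>) * (of_real x - cnj \<gamma>) = complex_of_real ((x - Re \<gamma>)\<^sup>2 + (Im \<gamma>)\<^sup>2)"
    by (simp add: complex_eq_iff power2_eq_square algebra_simps)
  then show ?thesis
    by (simp add: cauchy_density_def)
qed

text \<open>
  Subtracting \<open>g \<gamma>\<close> removes the only pole of the integrand in the upper half plane, so its
  integral over the boundary of the half disc vanishes and the real segment contributes as much
  as the arc, up to sign. On the arc the kernel is of order \<open>R\<^sup>-\<^sup>2\<close> and the length is \<open>\<pi> R\<close>.
\<close>
lemma half_disc_integral_bound: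
  fixes g :: "complex \<Rightarrow> complex"
  assumes \<gamma>: "0 < Im \<gamma>" and R: "2 * norm \<gamma> < R"
    and cont: "continuous_on {z. 0 \<le> Im z} g"
    and holo: "g holomorphic_on {z. 0 < Im z}"
    and bound: "\<And>z. 0 \<le> Im z \<Longrightarrow> norm z = R \<Longrightarrow> norm (g z) \<le> B"
  shows "norm (integral {-R..R} (\<lambda>x. of_real (cauchy_density \<gamma> x) * (g (of_real x) - g \<gamma>)))
      \<le> 4 * Im \<gamma> * (B + norm (g \<gamma>)) / R"
proof -
  define f where "f = (\<lambda>w. of_real (Im \<gamma> / pi) * (g w - g \<gamma>) / (w - cnj \<gamma>))"
  define h where "h = (\<lambda>w. f w / (w - \<gamma>))"
  define P where "P = linepath (- of_real R) (of_real R) +++ part_circlepath 0 R 0 pi"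
  have R0: "0 < R" using R by (meson le_less_trans mult_nonneg_nonneg norm_ge_zero zero_le_numeral)
  have int_uhp: "interior {z::complex. 0 \<le> Im z} = {z. 0 < Im z}"
    using interior_halfspace_ge[of "\<i>" 0] by (simp add: inner_complex_def)
  have ne: "w \<noteq> cnj \<gamma>" if "0 \<le> Im w" for w
    using that \<gamma> by auto
  have arc: "0 \<le> Im w \<and> norm w = R" if "w \<in> path_image (part_circlepath 0 R 0 pi)" for w
    using that R0 by (auto simp: path_image_part_circlepath cis_conv_exp[symmetric] norm_mult sin_ge_zero)
  have seg: "Im w = 0" if "w \<in> closed_segment (- of_real R) (complex_of_real R)" for w
    using that by (auto simp: closed_segment_def)
  have img: "path_image P \<subseteq> {z. 0 \<le> Im z} - {\<gamma>}"
  proof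
    fix w assume "w \<in> path_image P"
    then consider "w \<in> closed_segment (- of_real R) (complex_of_real R)"
      | "w \<in> path_image (part_circlepath 0 R 0 pi)"
      using path_image_join_subset unfolding P_def by fastforce
    then show "w \<in> {z. 0 \<le> Im z} - {\<gamma>}"
    proof cases
      case 1
      then show ?thesis using seg[of w] \<gamma> by auto
    next
      case 2
      then have "0 \<le> Im w" "norm w = R" using arc by auto
      then show ?thesis using R norm_ge_zero[of \<gamma>] by auto
    qed
  qed
  \<comment> \<open>As \<open>f \<gamma> = 0\<close>, Cauchy's formula yields 0 whatever the winding number is.\<close>
  have "((\<lambda>w. f w / (w - \<gamma>)) has_contour_integral (2 * pi * \<i> * winding_number P \<gamma> * f \<gamma>)) P"
  proof (rule Cauchy_integral_formula_weak[where S = "{z. 0 \<le> Im z}" and k = "{}"])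
    show "continuous_on {z. 0 \<le> Im z} f"
      unfolding f_def using ne by (intro continuous_intros cont) auto
    have "f holomorphic_on {z. 0 < Im z}"
      unfolding f_def using ne by (intro holomorphic_intros holo) (auto simp: less_imp_le)
    then show "f field_differentiable at x" if "x \<in> interior {z. 0 \<le> Im z} - {}" for x
      using that open_halfspace_Im_gt[of 0]
      by (auto simp: int_uhp holomorphic_on_open field_differentiable_def)
    show "\<gamma> \<in> interior {z. 0 \<le> Im z} - {}"
      using \<gamma> by (simp add: int_uhp)
  qed (use img in \<open>auto simp: P_def convex_halfspace_Im_ge\<close>)
  then have h0: "(h has_contour_integral 0) P"
    by (simp add: h_def f_def)
  define J where "J = contour_integral (part_circlepath 0 R 0 pi) h"
  have "h contour_integrable_on P"
    using h0 by (auto simp: contour_integrable_on_def)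
  then have hi: "h contour_integrable_on linepath (- of_real R) (of_real R)"
      "h contour_integrable_on part_circlepath 0 R 0 pi"
    unfolding P_def by (auto simp: contour_integrable_join)
  then have "contour_integral (linepath (- of_real R) (of_real R)) h + J = 0"
    using h0 contour_integral_join[OF _ _ , of h "linepath (- of_real R) (of_real R)" "part_circlepath 0 R 0 pi"]
    by (metis J_def P_def contour_integral_unique valid_path_linepath valid_path_part_circlepath)
  moreover have "contour_integral (linepath (- of_real R) (of_real R)) h
      = integral {-R..R} (\<lambda>x. h (of_real x))"
    using R0 by (subst contour_integral_linepath_Reals_eq) auto
  moreover have "h (of_real x) = of_real (cauchy_density \<gamma> x) * (g (of_real x) - g \<gamma>)" for x
    unfolding cauchy_density_eq by (simp add: h_def f_def)
  ultimately have eq: "norm (integral {-R..R} (\<lambda>x. of_real (cauchy_density \<gamma> x) * (g (of_real x) - g \<gamma>)))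
      = norm J"
    by (simp add: add_eq_0_iff2 norm_minus_commute)
  define b where "b = Im \<gamma> / pi * (B + norm (g \<gamma>)) / (R / 2 * (R / 2))"
  have B0: "0 \<le> B"
    using bound[of "of_real R"] R0 norm_ge_zero[of "g (of_real R)"] by (auto simp del: norm_ge_zero)
  have b0: "0 \<le> b"
    unfolding b_def using B0 \<gamma> R0 by auto
  have "norm J \<le> b * R * (pi - 0)"
  proof (rule has_contour_integral_bound_part_circlepath)
    show "(h has_contour_integral J) (part_circlepath 0 R 0 pi)"
      using hi(2) by (simp add: J_def has_contour_integral_integral)
    fix w assume "w \<in> path_image (part_circlepath 0 R 0 pi)"
    then have w: "0 \<le> Im w" "norm w = R" using arc by auto
    have 1: "R / 2 \<le> norm (w - \<gamma>)" "R / 2 \<le> norm (w - cnj \<gamma>)"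
      using norm_triangle_ineq2[of w \<gamma>] norm_triangle_ineq2[of w "cnj \<gamma>"] w R by auto
    have "norm (h w) = Im \<gamma> / pi * norm (g w - g \<gamma>) / (norm (w - cnj \<gamma>) * norm (w - \<gamma>))"
      using \<gamma> by (simp add: h_def f_def norm_divide norm_mult)
    also have "\<dots> \<le> b"
      unfolding b_def using 1 \<gamma> R0 B0 bound[OF w] norm_triangle_ineq4[of "g w" "g \<gamma>"]
      by (intro frac_le mult_mono mult_left_mono mult_nonneg_nonneg) auto
    finally show "norm (h w) \<le> b" .
  qed (use b0 R0 in auto)
  also have "b * R * (pi - 0) = 4 * Im \<gamma> * (B + norm (g \<gamma>)) / R"
    using R0 by (simp add: b_def field_simps)
  finally show ?thesis
    using eq by simp
qed

lemma cauchy_density_nonneg: "0 < Im \<gamma> \<Longrightarrow> 0 \<le> cauchy_density \<gamma> x"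
  by (simp add: cauchy_density_def)

lemma cauchy_density_measurable [measurable]: "cauchy_density \<gamma> \<in> borel_measurable borel"
  unfolding cauchy_density_def by measurable

text \<open>
  The arc contributes at most a multiple of \<open>B R / R\<close> to the half disc of radius \<open>R\<close>, and
  this tends to 0 by sublinear growth; that the density has mass 1 restores the subtracted
  constant.
\<close>
theorem Poisson_upper_half_plane:
  fixes g :: "complex \<Rightarrow> complex"
  assumes \<gamma>: "0 < Im \<gamma>"
    and one: "has_bochner_integral lborel (cauchy_density \<gamma>) 1"
    and cont: "continuous_on {z. 0 \<le> Im z} g"
    and holo: "g holomorphic_on {z. 0 < Im z}"
    and bound: "\<And>z. 0 \<le> Im z \<Longrightarrow> norm (g z) \<le> B (norm z)"
    and sublinear: "((\<lambda>R. B R / R) \<longlongrightarrow> 0) at_top"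
    and int: "integrable lborel (\<lambda>x. of_real (cauchy_density \<gamma> x) * g (of_real x))"
  shows "(\<integral>x. of_real (cauchy_density \<gamma> x) * g (of_real x) \<partial>lborel) = g \<gamma>"
proof -
  define k where "k = (\<lambda>x. of_real (cauchy_density \<gamma> x) * (g (of_real x) - g \<gamma>))"
  have one': "has_bochner_integral lborel (\<lambda>x. complex_of_real (cauchy_density \<gamma> x) * g \<gamma>) (1 * g \<gamma>)"
    using has_bochner_integral_of_real[OF one, where 'a = complex]
    by (intro has_bochner_integral_mult_left) auto
  have k: "integrable lborel k" and k_eq: "(\<integral>x. k x \<partial>lborel) =
      (\<integral>x. of_real (cauchy_density \<gamma> x) * g (of_real x) \<partial>lborel) - g \<gamma>"
    using int one' unfolding k_def right_diff_distrib
    by (auto simp: has_bochner_integral_iff)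
  have "((\<lambda>R. \<integral>x\<in>{-R..R}. k x \<partial>lborel) \<longlongrightarrow> (\<integral>x. k x \<partial>lborel)) at_top"
    unfolding set_lebesgue_integral_def
  proof (rule integral_dominated_convergence_at_top[where w = "\<lambda>x. norm (k x)"])
    show "\<forall>\<^sub>F R in at_top. AE x in lborel. norm (indicat_real {-R..R} x *\<^sub>R k x) \<le> norm (k x)"
      by (auto split: split_indicator)
    show "AE x in lborel. ((\<lambda>R. indicat_real {-R..R} x *\<^sub>R k x) \<longlongrightarrow> k x) at_top"
    proof (rule AE_I2, rule tendsto_eventually)
      fix x :: real
      show "\<forall>\<^sub>F R in at_top. indicat_real {-R..R} x *\<^sub>R k x = k x"
        using eventually_ge_at_top[of "\<bar>x\<bar>"] by eventually_elim (simp add: abs_le_iff)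
    qed
  qed (use k in auto)
  moreover have "((\<lambda>R. \<integral>x\<in>{-R..R}. k x \<partial>lborel) \<longlongrightarrow> 0) at_top"
  proof (rule Lim_null_comparison)
    have "((\<lambda>R. 4 * Im \<gamma> * (B R / R + norm (g \<gamma>) / R)) \<longlongrightarrow> 4 * Im \<gamma> * (0 + 0)) at_top"
      by (intro tendsto_intros sublinear tendsto_divide_0[OF tendsto_const] filterlim_at_top_imp_at_infinity filterlim_ident)
    then show "((\<lambda>R. 4 * Im \<gamma> * (B R / R + norm (g \<gamma>) / R)) \<longlongrightarrow> 0) at_top"
      by simp
    show "\<forall>\<^sub>F R in at_top. norm (\<integral>x\<in>{-R..R}. k x \<partial>lborel) \<le> 4 * Im \<gamma> * (B R / R + norm (g \<gamma>) / R)"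
      using eventually_gt_at_top[of "2 * norm \<gamma>"]
    proof eventually_elim
      case (elim R)
      have "set_integrable lborel {-R..R} k"
        unfolding set_integrable_def by (intro integrable_mult_indicator k) auto
      then have "(\<integral>x\<in>{-R..R}. k x \<partial>lborel) = integral {-R..R} k"
        by (rule set_borel_integral_eq_integral)
      moreover have "norm (g z) \<le> B R" if "0 \<le> Im z" "norm z = R" for z
        using bound[OF that(1)] that(2) by simp
      ultimately show ?case
        using half_disc_integral_bound[OF \<gamma> elim cont holo, of "B R"]
        by (simp add: k_def add_divide_distrib algebra_simps)
    qed
  qed
  ultimately have "(\<integral>x. k x \<partial>lborel) = 0"
    using tendsto_unique trivial_limit_at_top_linorder by blast
  then show ?thesis
    using k_eq by simp
qed

section \<open>A nearly linear weight that the Cauchy law integrates\<close>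

text \<open>
  The factor \<open>2 * exp 2\<close> absorbs the constants of the lemma that follows and makes the weight at
  least 1 on \<open>[1, \<infinity>)\<close>, so that further factors may be added to a product of weights.
\<close>
definition log_weight :: "real \<Rightarrow> real" where
  "log_weight t = 2 * exp 2 * t / (2 + ln t)\<^sup>2"

lemma log_weight_measurable [measurable]: "log_weight \<in> borel_measurable borel"
  unfolding log_weight_def by measurable

text \<open>
  With \<open>x = \<epsilon> (2 + log t)\<close> this is the elementary \<open>x\<^sup>2 / 2 \<le> exp x\<close>. The constant 2 next to
  the logarithm, rather than 1, makes the weight increasing on \<open>[1, \<infinity>)\<close>.
\<close>
lemma powr_le_log_weight:
  assumes "1 \<le> t" "0 < \<epsilon>" "\<epsilon> \<le> 1"
  shows "\<epsilon>\<^sup>2 * t powr (1 - \<epsilon>) \<le> log_weight t"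
proof -
  define x where "x = \<epsilon> * (2 + ln t)"
  have x: "0 \<le> x" using assms by (simp add: x_def)
  have "\<epsilon>\<^sup>2 * (2 + ln t)\<^sup>2 = x\<^sup>2" by (simp add: x_def power_mult_distrib)
  also have "\<dots> \<le> 2 * exp x" using exp_lower_Taylor_quadratic[OF x] x by simp
  also have "exp x = exp (2 * \<epsilon>) * t powr \<epsilon>"
    using assms by (simp add: x_def powr_def exp_add[symmetric] algebra_simps)
  also have "2 * (exp (2 * \<epsilon>) * t powr \<epsilon>) \<le> 2 * (exp 2 * t powr \<epsilon>)"
    using assms by (intro mult_left_mono mult_right_mono) auto
  finally have "\<epsilon>\<^sup>2 * (2 + ln t)\<^sup>2 * t powr (1 - \<epsilon>) \<le> 2 * (exp 2 * t powr \<epsilon>) * t powr (1 - \<epsilon>)"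
    by (rule mult_right_mono) simp
  also have "\<dots> = 2 * exp 2 * t"
    using assms by (simp add: powr_diff)
  finally have "\<epsilon>\<^sup>2 * t powr (1 - \<epsilon>) * (2 + ln t)\<^sup>2 \<le> 2 * exp 2 * t"
    by (simp add: ac_simps)
  moreover have "0 < (2 + ln t)\<^sup>2"
    using ln_ge_zero[OF assms(1)] by (intro zero_less_power) linarith
  ultimately show ?thesis
    by (simp add: log_weight_def le_divide_eq)
qed

lemma log_weight_ge_1: "1 \<le> t \<Longrightarrow> 1 \<le> log_weight t"
  using powr_le_log_weight[of t 1] by simp

lemma log_weight_mono:
  assumes "1 \<le> s" "s \<le> t"
  shows "log_weight s \<le> log_weight t"
proof (rule DERIV_nonneg_imp_nondecreasing[OF assms(2)])
  fix x assume "s \<le> x" "x \<le> t"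
  then have x: "0 < x" "0 \<le> ln x"
    using assms by auto
  then have x': "ln x + 2 \<noteq> 0"
    by linarith
  show "\<exists>y. DERIV log_weight x :> y \<and> 0 \<le> y"
    unfolding log_weight_def
  proof (intro exI conjI)
    show "DERIV (\<lambda>t. 2 * exp 2 * t / (2 + ln t)\<^sup>2) x :> 2 * exp 2 * ln x / (2 + ln x) ^ 3"
      using x x' by (auto intro!: derivative_eq_intros simp: divide_simps power2_eq_square power3_eq_cube)
        (simp add: algebra_simps)
    show "0 \<le> 2 * exp 2 * ln x / (2 + ln x) ^ 3"
      using x by simp
  qed
qed

lemma log_weight_mult_le:
  assumes "1 \<le> a" "1 \<le> t"
  shows "log_weight (a * t) \<le> a * log_weight t"
proof -
  have "2 + ln t \<le> 2 + ln (a * t)" "0 < 2 + ln t"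
    using assms by (simp_all add: ln_mult add_pos_nonneg)
  then have "(2 + ln t)\<^sup>2 \<le> (2 + ln (a * t))\<^sup>2" "0 < (2 + ln t)\<^sup>2"
    by (auto intro: power_mono)
  then have "2 * exp 2 * (a * t) / (2 + ln (a * t))\<^sup>2 \<le> 2 * exp 2 * (a * t) / (2 + ln t)\<^sup>2"
    using assms by (intro divide_left_mono mult_pos_pos) auto
  then show ?thesis
    by (simp add: log_weight_def ac_simps)
qed

text \<open>
  The shift by \<open>\<alpha>\<close> costs a constant factor only, so one integral, without shift, settles
  integrability for every \<open>\<alpha>\<close>.
\<close>
lemma log_weight_norm_add_le:
  fixes z \<alpha> :: complex
  shows "log_weight (1 + norm (z + \<alpha>)) \<le> (1 + norm \<alpha>) * log_weight (1 + norm z)"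
proof -
  have "(1 + norm \<alpha>) * (1 + norm z) = 1 + norm z + norm \<alpha> + norm \<alpha> * norm z"
    by (simp add: algebra_simps)
  then have "1 + norm (z + \<alpha>) \<le> (1 + norm \<alpha>) * (1 + norm z)"
    using norm_triangle_ineq[of z \<alpha>] mult_nonneg_nonneg[OF norm_ge_zero[of \<alpha>] norm_ge_zero[of z]]
    by linarith
  then have "log_weight (1 + norm (z + \<alpha>)) \<le> log_weight ((1 + norm \<alpha>) * (1 + norm z))"
    by (intro log_weight_mono) auto
  also have "\<dots> \<le> (1 + norm \<alpha>) * log_weight (1 + norm z)"
    by (intro log_weight_mult_le) auto
  finally show ?thesis .
qed

lemma log_weight_sublinear: "((\<lambda>R. log_weight (1 + R) / R) \<longlongrightarrow> 0) at_top"
  unfolding log_weight_def by real_asymp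

text \<open>
  On the positive half line the integrand is the derivative of a multiple of
  \<open>- 1 / (2 + log (1 + x))\<close>, which is bounded; the other half line follows by reflection.
\<close>
lemma integrable_log_weight_over_square:
  "integrable lborel (\<lambda>x::real. log_weight (1 + \<bar>x\<bar>) / (1 + \<bar>x\<bar>)\<^sup>2)"
proof -
  define f where "f = (\<lambda>x::real. indicator {0..} x * (log_weight (1 + \<bar>x\<bar>) / (1 + \<bar>x\<bar>)\<^sup>2))"
  have nn: "0 \<le> f x" for x
    using log_weight_ge_1[of "1 + \<bar>x\<bar>"] by (auto simp: f_def split: split_indicator)
  define F where "F = (\<lambda>x::real. - (2 * exp 2) / (2 + ln (1 + x)))"
  define g where "g = (\<lambda>x::real. 2 * exp 2 / ((1 + x) * (2 + ln (1 + x))\<^sup>2))"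
  have "(\<integral>\<^sup>+x. ennreal (g x) * indicator {0..} x \<partial>lborel) = ennreal (0 - F 0)"
  proof (rule nn_integral_FTC_atLeast)
    show "g \<in> borel_measurable borel" unfolding g_def by measurable
    show "(F \<longlongrightarrow> 0) at_top" unfolding F_def by real_asymp
    fix x :: real assume x: "0 \<le> x"
    then show "0 \<le> g x" by (simp add: g_def)
    have "0 < 2 + ln (1 + x)" using x by (simp add: add_pos_nonneg)
    then show "DERIV F x :> g x"
      using x unfolding F_def g_def
      by (auto intro!: derivative_eq_intros simp: divide_simps power2_eq_square)
  qed
  moreover have "ennreal (g x) * indicator {0..} x = ennreal (f x)" for x
    by (auto simp: f_def g_def log_weight_def power2_eq_square split: split_indicator)
  ultimately have "(\<integral>\<^sup>+x. ennreal (f x) \<partial>lborel) < \<infinity>"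
    by simp
  then have f: "integrable lborel f"
    using nn by (intro integrableI_nonneg) (auto simp: f_def)
  then have f': "integrable lborel (\<lambda>x. f (- x))"
    using lborel_integrable_real_affine[of f "-1" 0] by simp
  show ?thesis
  proof (rule Bochner_Integration.integrable_bound[OF Bochner_Integration.integrable_add[OF f f']])
    show "AE x in lborel. norm (log_weight (1 + \<bar>x\<bar>) / (1 + \<bar>x\<bar>)\<^sup>2) \<le> norm (f x + f (- x))"
    proof (rule AE_I2)
      fix x :: real
      have "0 \<le> log_weight (1 + \<bar>x\<bar>)"
        using log_weight_ge_1[of "1 + \<bar>x\<bar>"] by simp
      then show "norm (log_weight (1 + \<bar>x\<bar>) / (1 + \<bar>x\<bar>)\<^sup>2) \<le> norm (f x + f (- x))"
        by (auto simp: f_def split: split_indicator)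
    qed
  qed measurable
qed

lemma cauchy_density_le:
  assumes "0 < Im \<gamma>"
  obtains C where "\<And>x. cauchy_density \<gamma> x \<le> C / (1 + \<bar>x\<bar>)\<^sup>2"
proof
  fix x :: real
  define m where "m = (1 + \<bar>Re \<gamma>\<bar>)\<^sup>2"
  define s where "s = (Im \<gamma>)\<^sup>2"
  define d where "d = (x - Re \<gamma>)\<^sup>2"
  have pos: "0 < s" "0 \<le> d" "0 \<le> m" using assms by (auto simp: s_def d_def m_def)
  have "(1 + \<bar>x\<bar>)\<^sup>2 \<le> ((1 + \<bar>Re \<gamma>\<bar>) + \<bar>x - Re \<gamma>\<bar>)\<^sup>2"
    by (intro power_mono) auto
  also have "\<dots> \<le> 2 * m + 2 * d"
    using sum_squares_bound[of "1 + \<bar>Re \<gamma>\<bar>" "\<bar>x - Re \<gamma>\<bar>"]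
    by (simp add: m_def d_def power2_sum)
  also have "\<dots> \<le> 2 * (m / s + 1) * (d + s)"
    using pos by (simp add: field_simps)
  finally have "(1 + \<bar>x\<bar>)\<^sup>2 \<le> 2 * (m / s + 1) * (d + s)" .
  moreover have "0 < (1 + \<bar>x\<bar>)\<^sup>2" by (intro zero_less_power) simp
  ultimately have "1 / (d + s) \<le> 2 * (m / s + 1) / (1 + \<bar>x\<bar>)\<^sup>2"
    using pos by (simp add: divide_simps mult.commute)
  then have "Im \<gamma> / pi * (1 / (d + s)) \<le> Im \<gamma> / pi * (2 * (m / s + 1) / (1 + \<bar>x\<bar>)\<^sup>2)"
    using assms by (intro mult_left_mono) auto
  then show "cauchy_density \<gamma> x \<le> Im \<gamma> / pi * (2 * ((1 + \<bar>Re \<gamma>\<bar>)\<^sup>2 / (Im \<gamma>)\<^sup>2 + 1)) / (1 + \<bar>x\<bar>)\<^sup>2"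
    by (simp add: cauchy_density_def d_def s_def m_def)
qed

lemma integrable_cauchy_log_weight:
  assumes "0 < Im \<gamma>"
  shows "integrable lborel (\<lambda>x. cauchy_density \<gamma> x * log_weight (1 + norm (of_real x + \<alpha> :: complex)))"
proof -
  obtain C where C: "\<And>x. cauchy_density \<gamma> x \<le> C / (1 + \<bar>x\<bar>)\<^sup>2"
    using cauchy_density_le[OF assms] by blast
  have "integrable lborel (\<lambda>x. C * (1 + norm \<alpha>) * (log_weight (1 + \<bar>x\<bar>) / (1 + \<bar>x\<bar>)\<^sup>2))"
    by (intro integrable_mult_right integrable_log_weight_over_square)
  then show ?thesis
  proof (rule Bochner_Integration.integrable_bound)
    show "AE x in lborel. norm (cauchy_density \<gamma> x * log_weight (1 + norm (of_real x + \<alpha>)))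
        \<le> norm (C * (1 + norm \<alpha>) * (log_weight (1 + \<bar>x\<bar>) / (1 + \<bar>x\<bar>)\<^sup>2))"
    proof (rule AE_I2)
      fix x :: real
      let ?d = "cauchy_density \<gamma> x" and ?l = "log_weight (1 + norm (of_real x + \<alpha>))"
      have nn: "0 \<le> ?d" "0 \<le> ?l"
        using cauchy_density_nonneg[OF assms] log_weight_ge_1[of "1 + norm (of_real x + \<alpha>)"] by auto
      have "?d * ?l \<le> (C / (1 + \<bar>x\<bar>)\<^sup>2) * ((1 + norm \<alpha>) * log_weight (1 + \<bar>x\<bar>))"
        using nn C[of x] log_weight_norm_add_le[of "of_real x" \<alpha>]
        by (intro mult_mono) (auto intro: order_trans)
      then have "?d * ?l \<le> C * (1 + norm \<alpha>) * (log_weight (1 + \<bar>x\<bar>) / (1 + \<bar>x\<bar>)\<^sup>2)"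
        by (simp add: ac_simps)
      moreover have "norm (?d * ?l) = ?d * ?l"
        using nn by simp
      ultimately show "norm (?d * ?l) \<le> norm (C * (1 + norm \<alpha>) * (log_weight (1 + \<bar>x\<bar>) / (1 + \<bar>x\<bar>)\<^sup>2))"
        unfolding real_norm_def by linarith
    qed
  qed measurable
qed

section \<open>Pointwise bounds for the power sum defect\<close>

definition power_sum_defect :: "real \<Rightarrow> 'i set \<Rightarrow> ('i \<Rightarrow> complex) \<Rightarrow> complex" where
  "power_sum_defect p I z =
     (\<Sum>i\<in>I. z i powr of_real p) powr of_real (1 / p) - (\<Sum>i\<in>I. z i)"

text \<open>
  A substitute for \<open>|w|\<^sup>p\<close> that is at least 1, which makes powers with different exponents
  comparable.
\<close>
abbreviation size_power :: "real \<Rightarrow> complex \<Rightarrow> real" where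
  "size_power p w \<equiv> (1 + norm w) powr p"

lemma size_power_ge_1: "0 \<le> p \<Longrightarrow> 1 \<le> size_power p w"
  by (simp add: ge_one_powr_ge_zero)

lemma norm_powr_le_size_power: "0 \<le> p \<Longrightarrow> norm (w powr of_real p) \<le> size_power p w"
  unfolding norm_powr_of_real by (intro powr_mono2) auto

lemma size_power_powr: "0 < p \<Longrightarrow> size_power p w powr (1 / p) = 1 + norm w"
  by (simp add: powr_powr)

lemma size_power_mono: "0 \<le> p \<Longrightarrow> norm w \<le> norm w' \<Longrightarrow> size_power p w \<le> size_power p w'"
  by (intro powr_mono2) auto

text \<open>
  The entry \<open>z m\<close> is singled out: \<open>z m\<close> is the \<open>1 / p\<close>-th power of \<open>(z m) powr p\<close>, and the
  mean value estimate compares it with the \<open>1 / p\<close>-th power of the full sum. The bound is useful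
  when \<open>m\<close> is an index of the largest entry, because the last sum omits it.
\<close>
lemma norm_power_sum_defect_le:
  assumes I: "finite I" "m \<in> I" and z: "\<And>i. i \<in> I \<Longrightarrow> 0 \<le> Im (z i)" and p: "0 < p" "p < 1"
  shows "norm (power_sum_defect p I z)
    \<le> (1 / p + 1) * (\<Sum>i\<in>I. size_power p (z i)) powr (1 / p - 1) * (\<Sum>i\<in>I - {m}. size_power p (z i))"
proof -
  define \<rho> where "\<rho> = (\<Sum>i\<in>I. size_power p (z i))"
  define T where "T = (\<Sum>i\<in>I - {m}. size_power p (z i))"
  define a where "a = (\<Sum>i\<in>I. z i powr of_real p)"
  have le_\<rho>: "size_power p (z i) \<le> \<rho>" if "i \<in> I" for i
    unfolding \<rho>_def using I that by (intro member_le_sum) auto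
  have "1 \<le> \<rho>"
    using le_\<rho>[OF I(2)] size_power_ge_1[of p "z m"] p by linarith
  have "norm a \<le> \<rho>"
    unfolding a_def \<rho>_def using p by (intro sum_norm_le norm_powr_le_size_power) auto
  moreover have "norm (z m powr of_real p) \<le> \<rho>"
    using le_\<rho>[OF I(2)] norm_powr_le_size_power[of p "z m"] p by linarith
  moreover have "0 \<le> Im a"
    unfolding a_def Im_sum using z p by (intro sum_nonneg Im_powr_nonneg) auto
  ultimately have "norm (a powr of_real (1 / p) - (z m powr of_real p) powr of_real (1 / p))
      \<le> 1 / p * \<rho> powr (1 / p - 1) * norm (a - z m powr of_real p)"
    using p z[OF I(2)] \<open>1 \<le> \<rho>\<close> by (intro norm_powr_diff_le Im_powr_nonneg) auto
  also have "(z m powr of_real p) powr of_real (1 / p) = z m"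
    using p z[OF I(2)] by (intro powr_powr_inverse) auto
  also have "a - z m powr of_real p = (\<Sum>i\<in>I - {m}. z i powr of_real p)"
    unfolding a_def using I by (simp add: sum.remove[of I m])
  also have "1 / p * \<rho> powr (1 / p - 1) * norm \<dots> \<le> 1 / p * \<rho> powr (1 / p - 1) * T"
    unfolding T_def using p
    by (intro mult_left_mono sum_norm_le norm_powr_le_size_power mult_nonneg_nonneg) auto
  finally have 1: "norm (a powr of_real (1 / p) - z m) \<le> 1 / p * \<rho> powr (1 / p - 1) * T" .
  have "norm (\<Sum>i\<in>I - {m}. z i) \<le> (\<Sum>i\<in>I - {m}. \<rho> powr (1 / p - 1) * size_power p (z i))"
  proof (rule sum_norm_le)
    fix i assume i: "i \<in> I - {m}"
    \<comment> \<open>Splitting off one factor puts the linear terms into the same shape as the bound above.\<close>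
    have "norm (z i) \<le> size_power p (z i) powr (1 / p - 1) * size_power p (z i)"
      using p by (simp add: powr_powr powr_add[symmetric] algebra_simps)
    also have "\<dots> \<le> \<rho> powr (1 / p - 1) * size_power p (z i)"
      using p i le_\<rho> by (intro mult_right_mono powr_mono2) auto
    finally show "norm (z i) \<le> \<rho> powr (1 / p - 1) * size_power p (z i)" .
  qed
  then have 2: "norm (\<Sum>i\<in>I - {m}. z i) \<le> \<rho> powr (1 / p - 1) * T"
    by (simp add: T_def sum_distrib_left)
  have "power_sum_defect p I z = (a powr of_real (1 / p) - z m) - (\<Sum>i\<in>I - {m}. z i)"
    unfolding power_sum_defect_def a_def using I by (simp add: sum.remove[of I m z])
  then have "norm (power_sum_defect p I z) \<le> 1 / p * \<rho> powr (1 / p - 1) * T + \<rho> powr (1 / p - 1) * T"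
    using 1 2 norm_triangle_ineq4[of "a powr of_real (1 / p) - z m" "\<Sum>i\<in>I - {m}. z i"] by simp
  also have "\<dots> = (1 / p + 1) * \<rho> powr (1 / p - 1) * T"
    by (simp add: algebra_simps)
  finally show ?thesis
    by (simp add: \<rho>_def T_def)
qed

text \<open>
  For entries of comparable size it is enough to estimate the two terms of the defect
  separately.
\<close>
lemma norm_power_sum_defect_le_crude:
  assumes I: "finite I" and p: "0 < p"
  shows "norm (power_sum_defect p I z) \<le> (real (card I) + 1) * (\<Sum>i\<in>I. size_power p (z i)) powr (1 / p)"
proof -
  define \<rho> where "\<rho> = (\<Sum>i\<in>I. size_power p (z i))"
  have "norm ((\<Sum>i\<in>I. z i powr of_real p) powr of_real (1 / p)) \<le> \<rho> powr (1 / p)"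
    unfolding norm_powr_of_real \<rho>_def using p
    by (intro powr_mono2 sum_norm_le norm_powr_le_size_power) auto
  moreover have "norm (\<Sum>i\<in>I. z i) \<le> (\<Sum>i\<in>I. \<rho> powr (1 / p))"
  proof (rule sum_norm_le)
    fix i assume i: "i \<in> I"
    have "norm (z i) \<le> size_power p (z i) powr (1 / p)"
      using p by (simp add: size_power_powr)
    also have "\<dots> \<le> \<rho> powr (1 / p)"
      unfolding \<rho>_def using p i I by (intro powr_mono2 member_le_sum) auto
    finally show "norm (z i) \<le> \<rho> powr (1 / p)" .
  qed
  ultimately show ?thesis
    unfolding power_sum_defect_def \<rho>_def[symmetric]
    using norm_triangle_ineq4[of "(\<Sum>i\<in>I. z i powr of_real p) powr of_real (1 / p)" "\<Sum>i\<in>I. z i"]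
    by (simp add: algebra_simps)
qed

lemma mult_le_prod:
  fixes f :: "'i \<Rightarrow> real"
  assumes "finite I" "i \<in> I" "j \<in> I" "i \<noteq> j" "\<And>k. k \<in> I \<Longrightarrow> 1 \<le> f k"
  shows "f i * f j \<le> (\<Prod>k\<in>I. f k)"
proof -
  have "(\<Prod>k\<in>I. f k) = f i * (f j * (\<Prod>k\<in>I - {i} - {j}. f k))"
    using assms by (simp add: prod.remove[of I i] prod.remove[of "I - {i}" j])
  moreover have "f i * f j * 1 \<le> f i * f j * (\<Prod>k\<in>I - {i} - {j}. f k)"
    using assms by (intro mult_left_mono prod_ge_1 mult_nonneg_nonneg) (auto intro: order_trans[of 0 1])
  ultimately show ?thesis
    by (simp add: mult.assoc)
qed

text \<open>
  The exponents on the left are \<open>1 - p\<close> and \<open>p\<close>, each less than 1, so each factor is covered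
  by one weight; the weights of all other entries are at least 1 and can be multiplied in. A
  product over all entries is what independence can integrate.
\<close>
lemma mixed_size_power_le:
  assumes I: "finite I" "i \<in> I" "j \<in> I" "i \<noteq> j" and p: "0 < p" "p < 1"
  shows "size_power p (z i) powr (1 / p - 1) * size_power p (z j)
    \<le> (\<Prod>k\<in>I. log_weight (1 + norm (z k))) / (p\<^sup>2 * (1 - p)\<^sup>2)"
proof -
  have pos: "0 < p\<^sup>2" "0 < (1 - p)\<^sup>2" using p by auto
  have "size_power p (z i) powr (1 / p - 1) = (1 + norm (z i)) powr (1 - p)"
    using p by (simp add: powr_powr right_diff_distrib)
  then have "size_power p (z i) powr (1 / p - 1) \<le> log_weight (1 + norm (z i)) / p\<^sup>2"
    using powr_le_log_weight[of "1 + norm (z i)" p] p pos by (simp add: field_simps)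
  moreover have "size_power p (z j) \<le> log_weight (1 + norm (z j)) / (1 - p)\<^sup>2"
    using powr_le_log_weight[of "1 + norm (z j)" "1 - p"] p pos by (simp add: field_simps)
  ultimately have "size_power p (z i) powr (1 / p - 1) * size_power p (z j)
      \<le> log_weight (1 + norm (z i)) / p\<^sup>2 * (log_weight (1 + norm (z j)) / (1 - p)\<^sup>2)"
    by (intro mult_mono) (auto intro: order_trans[OF powr_ge_zero])
  also have "\<dots> = log_weight (1 + norm (z i)) * log_weight (1 + norm (z j)) / (p\<^sup>2 * (1 - p)\<^sup>2)"
    by simp
  also have "\<dots> \<le> (\<Prod>k\<in>I. log_weight (1 + norm (z k))) / (p\<^sup>2 * (1 - p)\<^sup>2)"
    using I by (intro divide_right_mono mult_le_prod[of I i j "\<lambda>k. log_weight (1 + norm (z k))"])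
      (auto intro: log_weight_ge_1)
  finally show ?thesis .
qed

lemma exists_argmax:
  fixes f :: "'i \<Rightarrow> real"
  assumes "finite I" "I \<noteq> {}"
  obtains m where "m \<in> I" "\<And>i. i \<in> I \<Longrightarrow> f i \<le> f m"
proof -
  have "Max (f ` I) \<in> f ` I"
    using assms by (intro Max_in) auto
  then obtain m where m: "m \<in> I" "f m = Max (f ` I)"
    by force
  show ?thesis
  proof (rule that[OF m(1)])
    show "f i \<le> f m" if "i \<in> I" for i
      using assms that unfolding m(2) by simp
  qed
qed

text \<open>
  For a fixed exponent, single out the largest entry: the full sum is then at most \<open>card I\<close>
  times its power, so every term of the refined bound mixes two different entries and none is
  linear in one entry alone.
\<close>
lemma power_sum_defect_dominated:
  assumes I: "finite I" "I \<noteq> {}" and p: "0 < p" "p < 1"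
  obtains C where "\<And>z. (\<And>i. i \<in> I \<Longrightarrow> 0 \<le> Im (z i)) \<Longrightarrow>
    norm (power_sum_defect p I z) \<le> C * (\<Prod>i\<in>I. log_weight (1 + norm (z i)))"
proof
  let ?n = "real (card I)"
  fix z :: "'a \<Rightarrow> complex"
  assume z: "\<And>i. i \<in> I \<Longrightarrow> 0 \<le> Im (z i)"
  define W where "W = (\<Prod>i\<in>I. log_weight (1 + norm (z i)))"
  obtain m where m: "m \<in> I" "\<And>i. i \<in> I \<Longrightarrow> norm (z i) \<le> norm (z m)"
    using exists_argmax[OF I, of "\<lambda>i. norm (z i)"] by blast
  have W: "0 \<le> W"
    unfolding W_def by (intro prod_nonneg) (auto intro: order_trans[OF zero_le_one log_weight_ge_1])
  have "(\<Sum>i\<in>I. size_power p (z i)) \<le> ?n * size_power p (z m)"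
    using m p by (intro sum_bounded_above size_power_mono) auto
  then have "(\<Sum>i\<in>I. size_power p (z i)) powr (1 / p - 1) \<le> (?n * size_power p (z m)) powr (1 / p - 1)"
    using p by (intro powr_mono2 sum_nonneg) auto
  also have "\<dots> = ?n powr (1 / p - 1) * size_power p (z m) powr (1 / p - 1)"
    by (simp add: powr_mult)
  finally have 1: "(\<Sum>i\<in>I. size_power p (z i)) powr (1 / p - 1)
      \<le> ?n powr (1 / p - 1) * size_power p (z m) powr (1 / p - 1)" .
  have "(\<Sum>i\<in>I - {m}. size_power p (z m) powr (1 / p - 1) * size_power p (z i))
      \<le> (\<Sum>i\<in>I - {m}. W / (p\<^sup>2 * (1 - p)\<^sup>2))"
    unfolding W_def using I m p by (intro sum_mono mixed_size_power_le) auto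
  also have "\<dots> \<le> ?n * (W / (p\<^sup>2 * (1 - p)\<^sup>2))"
    unfolding sum_constant using I m W by (intro mult_right_mono) (auto simp: card_Diff_singleton)
  finally have 2: "size_power p (z m) powr (1 / p - 1) * (\<Sum>i\<in>I - {m}. size_power p (z i))
      \<le> ?n * (W / (p\<^sup>2 * (1 - p)\<^sup>2))"
    by (simp add: sum_distrib_left)
  have "norm (power_sum_defect p I z)
      \<le> (1 / p + 1) * (\<Sum>i\<in>I. size_power p (z i)) powr (1 / p - 1) * (\<Sum>i\<in>I - {m}. size_power p (z i))"
    by (rule norm_power_sum_defect_le) (use I m z p in auto)
  also have "\<dots> \<le> (1 / p + 1) * (?n powr (1 / p - 1) * size_power p (z m) powr (1 / p - 1))
      * (\<Sum>i\<in>I - {m}. size_power p (z i))"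
    using 1 p by (intro mult_left_mono mult_right_mono sum_nonneg) auto
  also have "\<dots> = (1 / p + 1) * ?n powr (1 / p - 1)
      * (size_power p (z m) powr (1 / p - 1) * (\<Sum>i\<in>I - {m}. size_power p (z i)))"
    by simp
  also have "\<dots> \<le> (1 / p + 1) * ?n powr (1 / p - 1) * (?n * (W / (p\<^sup>2 * (1 - p)\<^sup>2)))"
    using 2 p by (intro mult_left_mono) auto
  also have "\<dots> = (1 / p + 1) * ?n powr (1 / p - 1) * ?n / (p\<^sup>2 * (1 - p)\<^sup>2) * W"
    by simp
  finally show "norm (power_sum_defect p I z)
      \<le> (1 / p + 1) * ?n powr (1 / p - 1) * ?n / (p\<^sup>2 * (1 - p)\<^sup>2) * (\<Prod>i\<in>I. log_weight (1 + norm (z i)))"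
    unfolding W_def .
qed

text \<open>
  In terms of the ratio \<open>k = v / s \<in> [1/2, 1]\<close> one has \<open>((1 + k) / 2)\<^sup>4 \<le> k\<close>. The exponent
  \<open>3 / 4 < 1\<close> of \<open>s v\<close> that results after taking fourth roots keeps the bound integrable.
\<close>
lemma mean_power4_le:
  fixes s v :: real
  assumes "1 \<le> v" "v \<le> s" "s \<le> 2 * v"
  shows "((s + v) / 2) ^ 4 \<le> (s * v) ^ 3"
proof -
  define d where "d = s - v"
  have d: "0 \<le> d" "d \<le> v" "s = v + d" using assms by (auto simp: d_def)
  have dd: "d * d \<le> d * v" using d by (intro mult_left_mono) auto
  have "((s + v) / 2)\<^sup>2 = v * v + d * v + d * d / 4"
    by (simp add: d power2_eq_square field_simps)
  also have "\<dots> \<le> v * v + 5 / 4 * (d * v)" using dd by simp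
  finally have "(((s + v) / 2)\<^sup>2)\<^sup>2 \<le> (v * v + 5 / 4 * (d * v))\<^sup>2"
    by (intro power_mono) auto
  also have "\<dots> = v * v * (v * v + 5 / 2 * (d * v) + 25 / 16 * (d * d))"
    by (simp add: power2_eq_square field_simps)
  also have "\<dots> \<le> v * v * (v * v + 3 * (d * v) + 3 * (d * d) + d * d * d / v)"
  proof (rule mult_left_mono)
    have "0 \<le> d * v" "0 \<le> d * d" "0 \<le> d * d * d / v"
      using d assms by auto
    then show "v * v + 5 / 2 * (d * v) + 25 / 16 * (d * d) \<le> v * v + 3 * (d * v) + 3 * (d * d) + d * d * d / v"
      by linarith
  qed simp
  also have "\<dots> = s ^ 3 * v"
    using assms by (simp add: d power3_eq_cube field_simps)
  also have "\<dots> \<le> s ^ 3 * v ^ 3"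
    using assms by (intro mult_left_mono self_le_power) auto
  finally show ?thesis
    by (simp add: power_mult_distrib flip: power_mult)
qed

lemma mean_le_of_two_largest:
  assumes I: "finite I" "m \<in> I" and n: "2 \<le> card I" and "v \<le> s" "f m = s"
    and v: "\<And>i. i \<in> I - {m} \<Longrightarrow> f i \<le> v"
  shows "(\<Sum>i\<in>I. f i) \<le> real (card I) * ((s + v) / 2)"
proof -
  have "(\<Sum>i\<in>I - {m}. f i) \<le> (real (card I) - 1) * v"
    using sum_bounded_above[of "I - {m}" f v] v I n by (simp add: of_nat_diff)
  then have "(\<Sum>i\<in>I. f i) \<le> s + (real (card I) - 1) * v"
    using I \<open>f m = s\<close> by (simp add: sum.remove[of I m])
  moreover have "0 \<le> (real (card I) - 2) * (s - v)"
    using n \<open>v \<le> s\<close> by (intro mult_nonneg_nonneg) auto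
  ultimately show ?thesis
    by (simp add: algebra_simps)
qed

text \<open>
  Let \<open>s \<ge> v\<close> be the two largest among the numbers \<open>(1 + |z i|) powr p\<close>. Their overall mean
  is at most \<open>(s + v) / 2\<close>. If \<open>s \<le> 2 v\<close>, the mean is at most \<open>(s v) powr (3/4)\<close> and the crude
  bound yields the product of two \<open>3/4\<close>-th powers. If \<open>s > 2 v\<close>, the mean is at most \<open>3 s / 4\<close>,
  and the geometric factor \<open>(3/4) powr (1 / p)\<close> absorbs the polynomial in \<open>1 / p\<close> coming from
  the refined bound and from the weights.
\<close>
lemma power_sum_defect_uniformly_dominated:
  assumes I: "finite I" and n: "2 \<le> card I"
  shows "\<forall>\<^sub>F p in at_right 0. \<forall>z. (\<forall>i\<in>I. 0 \<le> Im (z i)) \<longrightarrow>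
    norm (power_sum_defect p I z) \<le>
      256 * (real (card I) + 1) * real (card I) powr (1 / p) * (\<Prod>i\<in>I. log_weight (1 + norm (z i)))"
proof -
  let ?n = "real (card I)"
  \<comment> \<open>The total factor that the second case below collects.\<close>
  have "((\<lambda>p::real. 4 * (1 / p)\<^sup>2 * (1 / p + 1) * (3 / 4) powr (1 / p - 1)) \<longlongrightarrow> 0) (at_right 0)"
    by real_asymp
  then have "\<forall>\<^sub>F p in at_right (0::real). 4 * (1 / p)\<^sup>2 * (1 / p + 1) * (3 / 4) powr (1 / p - 1) < 1"
    by (rule order_tendstoD) simp
  moreover have "\<forall>\<^sub>F p in at_right (0::real). p \<le> 1 / 2"
    by (rule eventually_mono[OF eventually_at_right_real[of 0 "1 / 2"]]) auto
  ultimately show ?thesis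
    using eventually_at_right_less
  proof eventually_elim
    case (elim p)
    then have p: "0 < p" "p \<le> 1 / 2"
      and small: "4 * (1 / p)\<^sup>2 * (1 / p + 1) * (3 / 4) powr (1 / p - 1) \<le> 1"
      by auto
    show ?case
    proof (intro allI impI)
      fix z :: "'a \<Rightarrow> complex"
      assume z: "\<forall>i\<in>I. 0 \<le> Im (z i)"
      define W where "W = (\<Prod>i\<in>I. log_weight (1 + norm (z i)))"
      have W: "0 \<le> W"
        unfolding W_def by (intro prod_nonneg) (auto intro: order_trans[OF zero_le_one log_weight_ge_1])
      have "I \<noteq> {}" using n by auto
      then obtain m where m: "m \<in> I" "\<And>i. i \<in> I \<Longrightarrow> norm (z i) \<le> norm (z m)"
        using exists_argmax[OF I, of "\<lambda>i. norm (z i)"] by blast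
      have "card (I - {m}) \<noteq> 0" using m n I by simp
      then have "I - {m} \<noteq> {}" by force
      then obtain k where k: "k \<in> I - {m}" "\<And>i. i \<in> I - {m} \<Longrightarrow> norm (z i) \<le> norm (z k)"
        using exists_argmax[of "I - {m}" "\<lambda>i. norm (z i)"] I by blast
      define s v \<rho> where "s = size_power p (z m)" and "v = size_power p (z k)"
        and "\<rho> = (\<Sum>i\<in>I. size_power p (z i))"
      have sv: "1 \<le> v" "v \<le> s" and v: "\<And>i. i \<in> I - {m} \<Longrightarrow> size_power p (z i) \<le> v"
        unfolding s_def v_def using m k p by (auto intro!: size_power_ge_1 size_power_mono)
      have \<rho>: "\<rho> \<le> ?n * ((s + v) / 2)"
        unfolding \<rho>_def by (rule mean_le_of_two_largest[OF I m(1) n sv(2) _ v]) (simp_all add: s_def)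
      have \<rho>_nonneg: "0 \<le> \<rho>"
        unfolding \<rho>_def by (intro sum_nonneg) simp
      have "norm (power_sum_defect p I z) \<le> 256 * (?n + 1) * ?n powr (1 / p) * W"
      proof (cases "s \<le> 2 * v")
        case True
        have "((s + v) / 2) powr (1 / p) = (((s + v) / 2) ^ 4) powr (1 / p / 4)"
          using sv p by (simp add: powr_powr flip: powr_numeral)
        also have "\<dots> \<le> ((s * v) ^ 3) powr (1 / p / 4)"
          using sv p True by (intro powr_mono2 mean_power4_le) auto
        also have "\<dots> = (s powr (1 / p)) powr (3 / 4) * (v powr (1 / p)) powr (3 / 4)"
          using sv p by (simp add: powr_powr powr_mult flip: powr_numeral)
        also have "\<dots> = (1 + norm (z m)) powr (1 - 1 / 4) * (1 + norm (z k)) powr (1 - 1 / 4)"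
          using p unfolding s_def v_def by (subst (1 2) size_power_powr) auto
        also have "\<dots> \<le> (16 * log_weight (1 + norm (z m))) * (16 * log_weight (1 + norm (z k)))"
          using powr_le_log_weight[of "1 + norm (z m)" "1 / 4"] powr_le_log_weight[of "1 + norm (z k)" "1 / 4"]
          by (intro mult_mono) (auto simp: power2_eq_square intro: order_trans[OF zero_le_one log_weight_ge_1])
        also have "\<dots> = 256 * (log_weight (1 + norm (z m)) * log_weight (1 + norm (z k)))"
          by simp
        also have "\<dots> \<le> 256 * W"
          unfolding W_def using I m k
          by (intro mult_left_mono mult_le_prod[of I m k "\<lambda>i. log_weight (1 + norm (z i))"])
            (auto intro: log_weight_ge_1)
        finally have *: "((s + v) / 2) powr (1 / p) \<le> 256 * W" .
        have "norm (power_sum_defect p I z) \<le> (?n + 1) * \<rho> powr (1 / p)"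
          unfolding \<rho>_def by (rule norm_power_sum_defect_le_crude[OF I p(1)])
        also have "\<dots> \<le> (?n + 1) * (?n * ((s + v) / 2)) powr (1 / p)"
          using \<rho> \<rho>_nonneg p by (intro mult_left_mono powr_mono2) auto
        also have "\<dots> = (?n + 1) * (?n powr (1 / p) * ((s + v) / 2) powr (1 / p))"
          by (subst powr_mult) (use sv in auto)
        also have "\<dots> \<le> (?n + 1) * (?n powr (1 / p) * (256 * W))"
          using * by (intro mult_left_mono) auto
        finally show ?thesis
          by (simp add: algebra_simps)
      next
        case False
        \<comment> \<open>As \<open>p \<le> 1/2\<close>, the factor \<open>(1 - p)\<^sup>2\<close> stays away from 0.\<close>
        have "s powr (1 / p - 1) * v \<le> W / (p\<^sup>2 * (1 - p)\<^sup>2)"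
          unfolding s_def v_def W_def using I m k p by (intro mixed_size_power_le) auto
        also have "\<dots> \<le> W / (p\<^sup>2 * (1 / 2)\<^sup>2)"
          using p W by (intro divide_left_mono mult_left_mono power_mono mult_pos_pos) auto
        also have "\<dots> = 4 * (1 / p)\<^sup>2 * W"
          by (simp add: power2_eq_square)
        finally have *: "s powr (1 / p - 1) * v \<le> 4 * (1 / p)\<^sup>2 * W" .
        have "(\<Sum>i\<in>I - {m}. size_power p (z i)) \<le> ?n * v"
        proof -
          have "(\<Sum>i\<in>I - {m}. size_power p (z i)) \<le> real (card (I - {m})) * v"
            using v by (intro sum_bounded_above) auto
          also have "\<dots> \<le> ?n * v"
            using sv I by (intro mult_right_mono) (auto intro: card_mono)
          finally show ?thesis .
        qed
        moreover have "\<rho> \<le> ?n * (3 / 4 * s)"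
          using \<rho> False n by (elim order_trans, intro mult_left_mono) auto
        then have "\<rho> powr (1 / p - 1) \<le> (?n * (3 / 4 * s)) powr (1 / p - 1)"
          using \<rho>_nonneg p by (intro powr_mono2) auto
        moreover have "norm (power_sum_defect p I z)
            \<le> (1 / p + 1) * \<rho> powr (1 / p - 1) * (\<Sum>i\<in>I - {m}. size_power p (z i))"
          unfolding \<rho>_def by (rule norm_power_sum_defect_le) (use I m z p in auto)
        ultimately have "norm (power_sum_defect p I z)
            \<le> (1 / p + 1) * (?n * (3 / 4 * s)) powr (1 / p - 1) * (?n * v)"
          using p by (elim order_trans) (intro mult_mono mult_nonneg_nonneg sum_nonneg, auto)
        also have "(?n * (3 / 4 * s)) powr (1 / p - 1)
            = ?n powr (1 / p - 1) * ((3 / 4) powr (1 / p - 1) * s powr (1 / p - 1))"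
          using sv by (simp add: powr_mult powr_divide)
        also have "(1 / p + 1) * (?n powr (1 / p - 1) * ((3 / 4) powr (1 / p - 1) * s powr (1 / p - 1))) * (?n * v)
            = (?n powr (1 / p - 1) * ?n) * ((1 / p + 1) * (3 / 4) powr (1 / p - 1)) * (s powr (1 / p - 1) * v)"
          by (simp only: ac_simps)
        also have "?n powr (1 / p - 1) * ?n = ?n powr (1 / p)"
          using n by (simp add: powr_diff)
        also have "?n powr (1 / p) * ((1 / p + 1) * (3 / 4) powr (1 / p - 1)) * (s powr (1 / p - 1) * v)
            \<le> ?n powr (1 / p) * ((1 / p + 1) * (3 / 4) powr (1 / p - 1)) * (4 * (1 / p)\<^sup>2 * W)"
          using * p by (intro mult_left_mono) auto
        also have "\<dots> = (4 * (1 / p)\<^sup>2 * (1 / p + 1) * (3 / 4) powr (1 / p - 1)) * (?n powr (1 / p) * W)"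
          by (simp only: ac_simps)
        also have "\<dots> \<le> (256 * (?n + 1)) * (?n powr (1 / p) * W)"
          using small W by (intro mult_right_mono mult_nonneg_nonneg) auto
        finally show ?thesis
          by (simp add: ac_simps)
      qed
      then show "norm (power_sum_defect p I z) \<le>
          256 * (?n + 1) * ?n powr (1 / p) * (\<Prod>i\<in>I. log_weight (1 + norm (z i)))"
        unfolding W_def .
    qed
  qed
qed

section \<open>The Poisson integral in several variables\<close>

definition cauchy_measure :: "complex \<Rightarrow> real measure" where
  "cauchy_measure \<gamma> = density lborel (\<lambda>x. ennreal (cauchy_density \<gamma> x))"

lemma sets_cauchy_measure [simp, measurable_cong]: "sets (cauchy_measure \<gamma>) = sets borel"
  by (simp add: cauchy_measure_def)

lemma space_cauchy_measure [simp]: "space (cauchy_measure \<gamma>) = UNIV"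
  by (simp add: cauchy_measure_def)

lemma integrable_cauchy_measure_iff:
  fixes f :: "real \<Rightarrow> 'b::{banach, second_countable_topology}"
  assumes "0 < Im \<gamma>" "f \<in> borel_measurable borel"
  shows "integrable (cauchy_measure \<gamma>) f \<longleftrightarrow> integrable lborel (\<lambda>x. cauchy_density \<gamma> x *\<^sub>R f x)"
  unfolding cauchy_measure_def using assms
  by (intro integrable_density) (auto simp: cauchy_density_nonneg)

lemma integral_cauchy_measure:
  fixes f :: "real \<Rightarrow> 'b::{banach, second_countable_topology}"
  assumes "0 < Im \<gamma>" "f \<in> borel_measurable borel"
  shows "(\<integral>x. f x \<partial>cauchy_measure \<gamma>) = (\<integral>x. cauchy_density \<gamma> x *\<^sub>R f x \<partial>lborel)"
  unfolding cauchy_measure_def using assms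
  by (intro integral_density) (auto simp: cauchy_density_nonneg)

lemma borel_measurable_boundary_values:
  assumes "continuous_on {z. 0 \<le> Im z} g"
  shows "(\<lambda>x::real. g (of_real x) :: complex) \<in> borel_measurable borel"
  by (intro borel_measurable_continuous_onI continuous_on_compose2[OF assms] continuous_intros) auto

lemma Poisson_cauchy_measure:
  assumes \<gamma>: "0 < Im \<gamma>" and prob: "prob_space (cauchy_measure \<gamma>)"
    and cont: "continuous_on {z. 0 \<le> Im z} g"
    and holo: "g holomorphic_on {z. 0 < Im z}"
    and bound: "\<And>z. 0 \<le> Im z \<Longrightarrow> norm (g z) \<le> B (norm z)"
    and sublinear: "((\<lambda>R. B R / R) \<longlongrightarrow> 0) at_top"
    and int: "integrable (cauchy_measure \<gamma>) (\<lambda>x. g (of_real x))"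
  shows "(\<integral>x. g (of_real x) \<partial>cauchy_measure \<gamma>) = g \<gamma>"
proof -
  interpret prob_space "cauchy_measure \<gamma>" by (rule prob)
  have "integrable (cauchy_measure \<gamma>) (\<lambda>_. 1::real)" "(\<integral>_. 1 \<partial>cauchy_measure \<gamma>) = (1::real)"
    using prob_space by auto
  then have one: "has_bochner_integral lborel (cauchy_density \<gamma>) 1"
    using integrable_cauchy_measure_iff[OF \<gamma>, of "\<lambda>_. 1::real"]
      integral_cauchy_measure[OF \<gamma>, of "\<lambda>_. 1::real"]
    by (simp add: has_bochner_integral_iff)
  have meas: "(\<lambda>x. g (of_real x)) \<in> borel_measurable borel"
    by (rule borel_measurable_boundary_values[OF cont])
  have "integrable lborel (\<lambda>x. of_real (cauchy_density \<gamma> x) * g (of_real x))"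
    using int \<gamma> meas by (simp add: integrable_cauchy_measure_iff scaleR_conv_of_real)
  from Poisson_upper_half_plane[OF \<gamma> one cont holo bound sublinear this] show ?thesis
    using \<gamma> meas by (simp add: integral_cauchy_measure scaleR_conv_of_real)
qed

text \<open>
  The points at which the induction over the variables evaluates: real coordinates in \<open>J\<close>, and
  \<open>\<gamma>\<close> in the coordinates that have already been integrated out.
\<close>
definition partly_real :: "complex \<Rightarrow> 'i set \<Rightarrow> ('i \<Rightarrow> real) \<Rightarrow> 'i \<Rightarrow> complex" where
  "partly_real \<gamma> J x = (\<lambda>i. if i \<in> J then of_real (x i) else \<gamma>)"

text \<open>
  By Fubini, one coordinate at a time is integrated out with the formula in one variable, which
  replaces it by \<open>\<gamma>\<close>. The product form of the majorant serves twice: it is integrable for the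
  product measure, and with all coordinates but one fixed it is a multiple of \<open>\<kappa>\<close>, hence
  sublinear.
\<close>
theorem Poisson_product:
  fixes F :: "('i \<Rightarrow> complex) \<Rightarrow> complex"
  assumes \<gamma>: "0 < Im \<gamma>" and prob: "prob_space (cauchy_measure \<gamma>)" and I: "finite I"
    and cont: "\<And>w i. i \<in> I \<Longrightarrow> (\<And>j. j \<in> I \<Longrightarrow> 0 \<le> Im (w j)) \<Longrightarrow>
      continuous_on {z. 0 \<le> Im z} (\<lambda>\<zeta>. F (w(i := \<zeta>)))"
    and holo: "\<And>w i. i \<in> I \<Longrightarrow> (\<And>j. j \<in> I \<Longrightarrow> 0 \<le> Im (w j)) \<Longrightarrow>
      (\<lambda>\<zeta>. F (w(i := \<zeta>))) holomorphic_on {z. 0 < Im z}"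
    and bound: "\<And>w. (\<And>j. j \<in> I \<Longrightarrow> 0 \<le> Im (w j)) \<Longrightarrow> norm (F w) \<le> C * (\<Prod>j\<in>I. \<kappa> (norm (w j)))"
    and sublinear: "((\<lambda>R. \<kappa> R / R) \<longlongrightarrow> 0) at_top"
    and int_\<kappa>: "integrable (cauchy_measure \<gamma>) (\<lambda>x. \<kappa> \<bar>x\<bar>)"
    and meas: "\<And>J. J \<subseteq> I \<Longrightarrow> (\<lambda>x. F (partly_real \<gamma> J x)) \<in> borel_measurable (Pi\<^sub>M J (\<lambda>_. borel))"
    and J: "J \<subseteq> I"
  shows "(\<integral>x. F (partly_real \<gamma> J x) \<partial>Pi\<^sub>M J (\<lambda>_. cauchy_measure \<gamma>)) = F (\<lambda>_. \<gamma>)"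
proof -
  interpret prob_space "cauchy_measure \<gamma>" by (rule prob)
  interpret product_sigma_finite "\<lambda>_::'i. cauchy_measure \<gamma>"
    by unfold_locales
  have upper: "0 \<le> Im (partly_real \<gamma> J x j)" for J x and j :: 'i
    using \<gamma> by (simp add: partly_real_def)
  have int: "integrable (Pi\<^sub>M J (\<lambda>_. cauchy_measure \<gamma>)) (\<lambda>x. F (partly_real \<gamma> J x))" if J: "J \<subseteq> I" for J
  proof (rule Bochner_Integration.integrable_bound)
    have "finite J" using J I finite_subset by blast
    then show "integrable (Pi\<^sub>M J (\<lambda>_. cauchy_measure \<gamma>))
        (\<lambda>x. C * (\<Prod>j\<in>I - J. \<kappa> (norm \<gamma>)) * (\<Prod>j\<in>J. \<kappa> \<bar>x j\<bar>))"
      using int_\<kappa> by (intro integrable_mult_right product_integrable_prod) auto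
    have "Pi\<^sub>M J (\<lambda>_. cauchy_measure \<gamma>) \<rightarrow>\<^sub>M borel = Pi\<^sub>M J (\<lambda>_. borel) \<rightarrow>\<^sub>M (borel :: complex measure)"
      by (intro measurable_cong_sets sets_PiM_cong) auto
    then show "(\<lambda>x. F (partly_real \<gamma> J x)) \<in> borel_measurable (Pi\<^sub>M J (\<lambda>_. cauchy_measure \<gamma>))"
      using meas[OF J] by blast
    show "AE x in Pi\<^sub>M J (\<lambda>_. cauchy_measure \<gamma>). norm (F (partly_real \<gamma> J x))
        \<le> norm (C * (\<Prod>j\<in>I - J. \<kappa> (norm \<gamma>)) * (\<Prod>j\<in>J. \<kappa> \<bar>x j\<bar>))"
    proof (rule AE_I2)
      fix x :: "'i \<Rightarrow> real"
      have "norm (F (partly_real \<gamma> J x)) \<le> C * (\<Prod>j\<in>I. \<kappa> (norm (partly_real \<gamma> J x j)))"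
        by (intro bound upper)
      also have "(\<Prod>j\<in>I. \<kappa> (norm (partly_real \<gamma> J x j)))
          = (\<Prod>j\<in>I - J. \<kappa> (norm (partly_real \<gamma> J x j))) * (\<Prod>j\<in>J. \<kappa> (norm (partly_real \<gamma> J x j)))"
        by (rule prod.subset_diff[OF J I])
      also have "\<dots> = (\<Prod>j\<in>I - J. \<kappa> (norm \<gamma>)) * (\<Prod>j\<in>J. \<kappa> \<bar>x j\<bar>)"
        by (intro arg_cong2[where f = "(*)"] prod.cong) (auto simp: partly_real_def)
      finally show "norm (F (partly_real \<gamma> J x))
          \<le> norm (C * (\<Prod>j\<in>I - J. \<kappa> (norm \<gamma>)) * (\<Prod>j\<in>J. \<kappa> \<bar>x j\<bar>))"
        unfolding real_norm_def by (simp only: mult.assoc)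
    qed
  qed
  have "finite J" using J I finite_subset by blast
  then show ?thesis
    using J
  proof (induction J rule: finite_induct)
    case empty
    then show ?case
      by (simp add: PiM_empty lebesgue_integral_count_space_finite partly_real_def)
  next
    case (insert i J)
    then have i: "i \<in> I" and J: "J \<subseteq> I" by auto
    have upd: "partly_real \<gamma> (insert i J) (x(i := y)) = (partly_real \<gamma> J x)(i := of_real y)" for x y
      using insert.hyps by (auto simp: partly_real_def fun_eq_iff)
    have same: "(partly_real \<gamma> J x)(i := \<gamma>) = partly_real \<gamma> J x" for x
      using insert.hyps by (auto simp: partly_real_def fun_eq_iff)
    have one: "(\<integral>y. F ((partly_real \<gamma> J x)(i := of_real y)) \<partial>cauchy_measure \<gamma>) = F (partly_real \<gamma> J x)" for x
    proof -
      define D where "D = C * (\<Prod>j\<in>I - {i}. \<kappa> (norm (partly_real \<gamma> J x j)))"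
      define g where "g = (\<lambda>\<zeta>. F ((partly_real \<gamma> J x)(i := \<zeta>)))"
      have bound_g: "norm (g z) \<le> D * \<kappa> (norm z)" if "0 \<le> Im z" for z
      proof -
        have "norm (g z) \<le> C * (\<Prod>j\<in>I. \<kappa> (norm (((partly_real \<gamma> J x)(i := z)) j)))"
          unfolding g_def using that upper by (intro bound) auto
        also have "\<dots> = D * \<kappa> (norm z)"
          unfolding D_def prod.remove[OF I i] by simp
        finally show ?thesis .
      qed
      have cont_g: "continuous_on {z. 0 \<le> Im z} g"
        unfolding g_def by (intro cont i upper)
      have "(\<integral>y. g (of_real y) \<partial>cauchy_measure \<gamma>) = g \<gamma>"
      proof (rule Poisson_cauchy_measure[OF \<gamma> prob cont_g _ bound_g])
        show "g holomorphic_on {z. 0 < Im z}"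
          unfolding g_def by (intro holo i upper)
        have "((\<lambda>R. D * (\<kappa> R / R)) \<longlongrightarrow> D * 0) at_top"
          by (intro tendsto_intros sublinear)
        then show "((\<lambda>R. D * \<kappa> R / R) \<longlongrightarrow> 0) at_top"
          by simp
        show "integrable (cauchy_measure \<gamma>) (\<lambda>y. g (of_real y))"
        proof (rule Bochner_Integration.integrable_bound)
          show "integrable (cauchy_measure \<gamma>) (\<lambda>y. D * \<kappa> \<bar>y\<bar>)"
            by (intro integrable_mult_right int_\<kappa>)
          show "(\<lambda>y. g (of_real y)) \<in> borel_measurable (cauchy_measure \<gamma>)"
            using borel_measurable_boundary_values[OF cont_g] by simp
          show "AE y in cauchy_measure \<gamma>. norm (g (of_real y)) \<le> norm (D * \<kappa> \<bar>y\<bar>)"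
          proof (rule AE_I2)
            fix y :: real
            have "norm (g (of_real y)) \<le> D * \<kappa> \<bar>y\<bar>"
              using bound_g[of "of_real y"] by simp
            then show "norm (g (of_real y)) \<le> norm (D * \<kappa> \<bar>y\<bar>)"
              by simp
          qed
        qed
      qed
      then show ?thesis
        by (simp add: g_def same)
    qed
    have "(\<integral>x. F (partly_real \<gamma> (insert i J) x) \<partial>Pi\<^sub>M (insert i J) (\<lambda>_. cauchy_measure \<gamma>))
        = (\<integral>x. (\<integral>y. F (partly_real \<gamma> (insert i J) (x(i := y))) \<partial>cauchy_measure \<gamma>) \<partial>Pi\<^sub>M J (\<lambda>_. cauchy_measure \<gamma>))"
      by (rule product_integral_insert[OF insert.hyps int[OF insert.prems]])
    then show ?case
      by (simp add: upd one insert.IH J)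
  qed
qed

section \<open>Limits as the exponent tends to zero\<close>

text \<open>
  Dominated convergence for a real parameter tending to 0 from above, reduced to a parameter
  tending to infinity by inversion.
\<close>
lemma dominated_tendsto_L1_at_right_0:
  fixes Y :: "real \<Rightarrow> 'a \<Rightarrow> complex"
  assumes [measurable]: "\<And>p. Y p \<in> borel_measurable M" "Z \<in> borel_measurable M"
    and W: "integrable M W"
    and bound: "\<forall>\<^sub>F p in at_right 0. \<forall>\<omega>. norm (Y p \<omega>) \<le> W \<omega>"
    and lim: "AE \<omega> in M. ((\<lambda>p. Y p \<omega>) \<longlongrightarrow> Z \<omega>) (at_right 0)"
  shows "tendsto_L1 M Y Z (at_right 0)"
proof -
  have Y: "\<forall>\<^sub>F p in at_right 0. integrable M (Y p)"
    using bound
  proof eventually_elim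
    case (elim p)
    show ?case
      by (rule Bochner_Integration.integrable_bound[OF W])
        (use elim in \<open>auto intro: AE_I2 order_trans[OF _ abs_ge_self]\<close>)
  qed
  have bound': "\<forall>\<^sub>F t in at_top. AE \<omega> in M. norm (Y (inverse t) \<omega>) \<le> W \<omega>"
    using eventually_compose_filterlim[OF bound filterlim_inverse_at_right_top]
    by (rule eventually_mono) simp
  have lim': "AE \<omega> in M. ((\<lambda>t. Y (inverse t) \<omega>) \<longlongrightarrow> Z \<omega>) at_top"
    using lim by eventually_elim (simp add: filterlim_at_right_to_top)
  have Z: "integrable M Z"
    by (rule integrable_dominated_convergence_at_top[OF _ _ W lim' bound']) auto
  have "((\<lambda>t. \<integral>\<omega>. norm (Y (inverse t) \<omega> - Z \<omega>) \<partial>M) \<longlongrightarrow> (\<integral>\<omega>. 0 \<partial>M)) at_top"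
  proof (rule integral_dominated_convergence_at_top[where w = "\<lambda>\<omega>. W \<omega> + norm (Z \<omega>)"])
    show "AE \<omega> in M. ((\<lambda>t. norm (Y (inverse t) \<omega> - Z \<omega>)) \<longlongrightarrow> 0) at_top"
      using lim'
    proof eventually_elim
      case (elim \<omega>)
      from tendsto_diff[OF elim tendsto_const, of "Z \<omega>"] show ?case
        by (simp add: tendsto_norm_zero)
    qed
    show "\<forall>\<^sub>F t in at_top. AE \<omega> in M. norm (norm (Y (inverse t) \<omega> - Z \<omega>)) \<le> W \<omega> + norm (Z \<omega>)"
      using bound'
    proof eventually_elim
      case (elim t)
      then show ?case
      proof eventually_elim
        case (elim \<omega>)
        then show ?case
          using norm_triangle_ineq4[of "Y (inverse t) \<omega>" "Z \<omega>"] by simp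
      qed
    qed
  qed (use W Z in auto)
  then have "((\<lambda>p. \<integral>\<omega>. norm (Y p \<omega> - Z \<omega>) \<partial>M) \<longlongrightarrow> 0) (at_right 0)"
    by (simp add: filterlim_at_right_to_top)
  then show ?thesis
    using Y Z by (simp add: tendsto_L1_def)
qed

text \<open>
  Take the difference quotient at 0 of \<open>c \<mapsto> log ((1/n) \<Sum> exp (c log z\<^sub>i))\<close>.
\<close>
lemma power_mean_tendsto_geometric_mean:
  fixes z :: "'i \<Rightarrow> complex"
  assumes I: "finite I" "I \<noteq> {}" and z: "\<And>i. i \<in> I \<Longrightarrow> z i \<noteq> 0"
  shows "((\<lambda>p. (1 / of_nat (card I) * (\<Sum>i\<in>I. z i powr of_real p)) powr of_real (1 / p))
    \<longlongrightarrow> (\<Prod>i\<in>I. z i powr of_real (1 / real (card I)))) (at_right 0)"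
proof -
  define n where "n = (of_nat (card I) :: complex)"
  have n: "n \<noteq> 0" using I by (simp add: n_def)
  define A where "A = (\<lambda>c::complex. 1 / n * (\<Sum>i\<in>I. exp (c * Ln (z i))))"
  have "(\<Sum>i\<in>I. exp (0 * Ln (z i))) = n"
    by (simp add: n_def)
  then have A0: "A 0 = 1"
    using n by (simp only: A_def) simp
  define L where "L = 1 / n * (\<Sum>i\<in>I. Ln (z i))"
  have dA: "(A has_field_derivative L) (at 0)"
    unfolding A_def L_def using n by (auto intro!: derivative_eq_intros sum.cong)
  have "((\<lambda>c. Ln (A c)) has_field_derivative (inverse (A 0) * L)) (at 0)"
    using DERIV_chain2[OF has_field_derivative_Ln dA] A0 by simp
  then have "((\<lambda>c. Ln (A c) / c) \<longlongrightarrow> L) (at 0)"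
    by (simp add: has_field_derivative_iff A0)
  moreover have "filterlim complex_of_real (at 0) (at_right 0)"
    unfolding filterlim_at using eventually_at_right_less[of "0::real"]
    by (auto intro!: tendsto_eq_intros elim!: eventually_mono)
  ultimately have "((\<lambda>p::real. Ln (A (of_real p)) / of_real p) \<longlongrightarrow> L) (at_right 0)"
    by (rule filterlim_compose)
  then have lim: "((\<lambda>p::real. exp (Ln (A (of_real p)) / of_real p)) \<longlongrightarrow> exp L) (at_right 0)"
    by (rule tendsto_exp)
  have "exp L = (\<Prod>i\<in>I. exp (Ln (z i) / n))"
    using I by (simp add: L_def sum_divide_distrib exp_sum)
  also have "\<dots> = (\<Prod>i\<in>I. z i powr of_real (1 / real (card I)))"
    using z by (intro prod.cong) (auto simp: powr_def n_def)
  finally have G: "exp L = (\<Prod>i\<in>I. z i powr of_real (1 / real (card I)))" .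
  have "isCont (\<lambda>p::real. A (of_real p)) 0"
    unfolding A_def by (intro continuous_intros)
  then have "((\<lambda>p::real. A (of_real p)) \<longlongrightarrow> 1) (at_right 0)"
    using A0 by (simp add: isCont_def filterlim_at_split)
  then have "\<forall>\<^sub>F p::real in at_right 0. A (of_real p) \<noteq> 0"
    by (rule tendsto_imp_eventually_ne) simp
  then have "\<forall>\<^sub>F p::real in at_right 0. exp (Ln (A (of_real p)) / of_real p)
      = (1 / of_nat (card I) * (\<Sum>i\<in>I. z i powr of_real p)) powr of_real (1 / p)"
  proof eventually_elim
    case (elim p)
    have "A (of_real p) = 1 / of_nat (card I) * (\<Sum>i\<in>I. z i powr of_real p)"
      unfolding A_def n_def using z by (intro arg_cong2[where f = "(*)"] sum.cong refl) (auto simp: powr_def)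
    then show ?case
      using elim by (simp add: powr_def)
  qed
  from Lim_transform_eventually[OF lim this] show ?thesis
    unfolding G .
qed

lemma power_arith_difference_eq:
  assumes "1 \<le> n" "0 < p"
  shows "of_real (real n powr (1 / p)) * power_mean \<alpha> p n x - of_nat n * arith_mean n x
    = power_sum_defect p {1..n} (\<lambda>j. of_real (x j) + \<alpha>) - of_real (real n powr (1 / p) - real n) * \<alpha>"
proof -
  define S where "S = (\<Sum>j=1..n. (of_real (x j) + \<alpha>) powr of_real p)"
  have "(1 / of_nat n * S) powr of_real (1 / p) = (1 / of_nat n) powr of_real (1 / p) * S powr of_real (1 / p)"
    by (rule powr_times_real_left) auto
  also have "(1 / of_nat n :: complex) powr of_real (1 / p) = of_real ((1 / real n) powr (1 / p))"
    by (simp flip: powr_of_real)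
  also have "(1 / real n) powr (1 / p) = 1 / real n powr (1 / p)"
    by (simp add: powr_divide)
  finally have e1: "of_real (real n powr (1 / p)) * power_mean \<alpha> p n x
      = S powr of_real (1 / p) - of_real (real n powr (1 / p)) * \<alpha>"
    using assms unfolding power_mean_def S_def[symmetric] by (simp add: field_simps)
  have e2: "of_nat n * arith_mean n x = (\<Sum>j=1..n. of_real (x j) + \<alpha>) - of_nat n * \<alpha>"
    using assms by (simp add: arith_mean_def sum.distrib)
  show ?thesis
    unfolding power_sum_defect_def S_def[symmetric] e1 e2 by (simp add: algebra_simps)
qed

lemma real_powr_inverse_gt:
  assumes "2 \<le> n" "0 < p" "p < 1"
  shows "real n < real n powr (1 / p)"
  using powr_less_mono[of 1 "1 / p" "real n"] assms by simp

text \<open>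
  Dividing numerator and denominator by \<open>n powr (1 / p)\<close> leaves the power mean plus terms
  multiplied by \<open>n powr (1 - 1 / p)\<close>, which tends to 0.
\<close>
lemma power_arith_ratio_tendsto_geom_mean:
  assumes n: "2 \<le> n" and z: "\<And>j. j \<in> {1..n} \<Longrightarrow> of_real (x j) + \<alpha> \<noteq> 0"
  shows "((\<lambda>p::real. (of_real (real n powr (1 / p)) * power_mean \<alpha> p n x - of_nat n * arith_mean n x)
      / of_real (real n powr (1 / p) - real n)) \<longlongrightarrow> geom_mean \<alpha> n x) (at_right 0)"
proof -
  have "((\<lambda>p. power_mean \<alpha> p n x) \<longlongrightarrow> geom_mean \<alpha> n x) (at_right 0)"
    unfolding power_mean_def geom_mean_def
    using power_mean_tendsto_geometric_mean[of "{1..n}" "\<lambda>j. of_real (x j) + \<alpha>"] n z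
    by (intro tendsto_diff tendsto_const) auto
  moreover have r: "((\<lambda>p. real n powr (1 - 1 / p)) \<longlongrightarrow> 0) (at_right 0)"
  proof -
    define c where "c = real n"
    have "1 < c" using n by (simp add: c_def)
    then show ?thesis unfolding c_def[symmetric] by real_asymp
  qed
  ultimately have "((\<lambda>p. (power_mean \<alpha> p n x - of_real (real n powr (1 - 1 / p)) * arith_mean n x)
      / (1 - of_real (real n powr (1 - 1 / p)))) \<longlongrightarrow>
      (geom_mean \<alpha> n x - of_real 0 * arith_mean n x) / (1 - of_real 0)) (at_right 0)"
    by (intro tendsto_intros) auto
  then have "((\<lambda>p. (power_mean \<alpha> p n x - of_real (real n powr (1 - 1 / p)) * arith_mean n x)
      / (1 - of_real (real n powr (1 - 1 / p)))) \<longlongrightarrow> geom_mean \<alpha> n x) (at_right 0)"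
    by simp
  moreover have "(power_mean \<alpha> p n x - of_real (real n powr (1 - 1 / p)) * arith_mean n x)
        / (1 - of_real (real n powr (1 - 1 / p)))
      = (of_real (real n powr (1 / p)) * power_mean \<alpha> p n x - of_nat n * arith_mean n x)
        / of_real (real n powr (1 / p) - real n)" for p
  proof -
    define c where "c = complex_of_real (real n powr (1 / p))"
    have c: "c \<noteq> 0" using n by (simp add: c_def)
    have e: "of_real (real n powr (1 - 1 / p)) = of_nat n / c"
      using n by (simp add: c_def powr_diff)
    show ?thesis
      using c n unfolding of_real_diff c_def[symmetric] e by (simp add: divide_simps)
  qed
  ultimately show ?thesis
    by simp
qed

section \<open>The power sum defect as an integrand\<close>

text \<open>
  As a function of one variable the defect is \<open>((\<zeta> + \<alpha>)\<^sup>p + c)\<^bsup>1/p\<^esup>\<close> minus an affine function,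
  where \<open>c\<close> collects the other entries. Both \<open>(\<zeta> + \<alpha>)\<^sup>p\<close> and \<open>c\<close> lie in the closed upper half
  plane, and the sum lies in the open one when \<open>\<zeta>\<close> does, so the outer power never meets its cut
  from below.
\<close>
lemma power_sum_defect_slice:
  assumes \<alpha>: "0 \<le> Im \<alpha>" and I: "finite I" "i \<in> I" and p: "0 < p" "p < 1"
    and w: "\<And>j. j \<in> I \<Longrightarrow> 0 \<le> Im (w j)"
  shows "continuous_on {z. 0 \<le> Im z} (\<lambda>\<zeta>. power_sum_defect p I (\<lambda>j. (w(i := \<zeta>)) j + \<alpha>))"
    and "(\<lambda>\<zeta>. power_sum_defect p I (\<lambda>j. (w(i := \<zeta>)) j + \<alpha>)) holomorphic_on {z. 0 < Im z}"
proof -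
  define c where "c = (\<Sum>j\<in>I - {i}. (w j + \<alpha>) powr of_real p)"
  define d where "d = (\<Sum>j\<in>I - {i}. w j + \<alpha>)"
  have c: "0 \<le> Im c"
    unfolding c_def Im_sum using w \<alpha> p by (intro sum_nonneg Im_powr_nonneg) auto
  have eq: "power_sum_defect p I (\<lambda>j. (w(i := \<zeta>)) j + \<alpha>)
      = ((\<zeta> + \<alpha>) powr of_real p + c) powr of_real (1 / p) - (\<zeta> + \<alpha> + d)" for \<zeta>
    unfolding power_sum_defect_def c_def d_def using I by (simp add: sum.remove[of I i])
  have inner: "continuous_on {z. 0 \<le> Im z} (\<lambda>\<zeta>. (\<zeta> + \<alpha>) powr of_real p + c)"
    using \<alpha> p
    by (intro continuous_intros continuous_on_compose2[OF continuous_on_powr_upper[of p]]) auto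
  show "continuous_on {z. 0 \<le> Im z} (\<lambda>\<zeta>. power_sum_defect p I (\<lambda>j. (w(i := \<zeta>)) j + \<alpha>))"
    unfolding eq using \<alpha> p c
    by (intro continuous_on_diff continuous_on_compose2[OF continuous_on_powr_upper[of "1 / p"] inner] continuous_intros)
      (auto intro!: add_nonneg_nonneg Im_powr_nonneg)
  have "\<zeta> + \<alpha> \<notin> \<real>\<^sub>\<le>\<^sub>0" "(\<zeta> + \<alpha>) powr of_real p + c \<notin> \<real>\<^sub>\<le>\<^sub>0" if "0 < Im \<zeta>" for \<zeta>
    using that \<alpha> c Im_powr_pos[of "\<zeta> + \<alpha>" p] p by (auto simp: complex_nonpos_Reals_iff)
  then show "(\<lambda>\<zeta>. power_sum_defect p I (\<lambda>j. (w(i := \<zeta>)) j + \<alpha>)) holomorphic_on {z. 0 < Im z}"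
    unfolding eq by (intro holomorphic_intros) auto
qed

lemma power_sum_defect_cong:
  "(\<And>i. i \<in> I \<Longrightarrow> z i = z' i) \<Longrightarrow> power_sum_defect p I z = power_sum_defect p I z'"
  by (simp add: power_sum_defect_def cong: sum.cong)

lemma power_sum_defect_measurable:
  assumes [measurable]: "\<And>i. i \<in> I \<Longrightarrow> (\<lambda>\<omega>. z \<omega> i) \<in> borel_measurable N"
  shows "(\<lambda>\<omega>. power_sum_defect p I (z \<omega>)) \<in> borel_measurable N"
  unfolding power_sum_defect_def by measurable

lemma power_sum_defect_const:
  assumes "0 \<le> Im c" "0 < p" "p < 1" "0 < card I"
  shows "power_sum_defect p I (\<lambda>_. c) = of_real (real (card I) powr (1 / p) - real (card I)) * c"
proof -
  have "(of_nat (card I) * c powr of_real p) powr of_real (1 / p)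
      = of_nat (card I) powr of_real (1 / p) * (c powr of_real p) powr of_real (1 / p)"
    by (rule powr_times_real_left) auto
  also have "(c powr of_real p) powr of_real (1 / p) = c"
    using assms by (intro powr_powr_inverse) auto
  also have "(of_nat (card I) :: complex) powr of_real (1 / p) = of_real (real (card I) powr (1 / p))"
    by (simp flip: powr_of_real)
  finally show ?thesis
    by (simp add: power_sum_defect_def algebra_simps)
qed

section \<open>Independent Cauchy variables\<close>

locale cauchy_sample = prob_space M for M :: "'a measure" +
  fixes X :: "nat \<Rightarrow> 'a \<Rightarrow> real" and \<gamma> :: complex
  assumes \<gamma>: "0 < Im \<gamma>" and iid: "iid_cauchy M X \<gamma>"
begin

lemma X_measurable: "1 \<le> j \<Longrightarrow> X j \<in> borel_measurable M"
  using iid by (auto simp: iid_cauchy_def distributed_def)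

lemma distr_X:
  assumes "1 \<le> j"
  shows "distr M borel (X j) = cauchy_measure \<gamma>"
proof -
  have "distributed M lborel (X j) (\<lambda>x. ennreal (cauchy_density \<gamma> x))"
    using iid assms by (simp add: iid_cauchy_def)
  then have "distr M lborel (X j) = cauchy_measure \<gamma>"
    unfolding cauchy_measure_def by (rule distributed_distr_eq_density)
  then show ?thesis
    by (simp cong: distr_cong)
qed

lemma prob_space_cauchy_measure: "prob_space (cauchy_measure \<gamma>)"
  using prob_space_distr[OF X_measurable[of 1]] distr_X[of 1] by simp

lemma distr_sample:
  assumes "1 \<le> n"
  shows "distr M (Pi\<^sub>M {1..n} (\<lambda>_. borel)) (\<lambda>\<omega>. \<lambda>j\<in>{1..n}. X j \<omega>) = Pi\<^sub>M {1..n} (\<lambda>_. cauchy_measure \<gamma>)"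
proof -
  have "indep_vars (\<lambda>_. borel) X {1..n}"
    using iid by (auto simp: iid_cauchy_def intro: indep_vars_subset)
  then have "distr M (Pi\<^sub>M {1..n} (\<lambda>_. borel)) (\<lambda>\<omega>. \<lambda>j\<in>{1..n}. X j \<omega>)
      = Pi\<^sub>M {1..n} (\<lambda>j. distr M borel (X j))"
    using assms X_measurable by (subst (asm) indep_vars_iff_distr_eq_PiM') auto
  also have "\<dots> = Pi\<^sub>M {1..n} (\<lambda>_. cauchy_measure \<gamma>)"
    by (intro PiM_cong refl) (simp add: distr_X)
  finally show ?thesis .
qed

lemma AE_X_add_nonzero:
  fixes \<alpha> :: complex
  shows "AE \<omega> in M. \<forall>j\<in>{1..n}. of_real (X j \<omega>) + \<alpha> \<noteq> 0"
proof (rule AE_ball_countable[THEN iffD2]; (intro ballI)?)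
  fix j assume "j \<in> {1..n}"
  then have j: "1 \<le> j" by simp
  have "AE x in cauchy_measure \<gamma>. x \<noteq> - Re \<alpha>"
    unfolding cauchy_measure_def using AE_lborel_singleton[of "- Re \<alpha>"]
    by (subst AE_density) (auto elim: eventually_mono)
  then have "AE \<omega> in M. X j \<omega> \<noteq> - Re \<alpha>"
    unfolding distr_X[OF j, symmetric] by (rule AE_distrD[OF X_measurable[OF j]])
  then show "AE \<omega> in M. of_real (X j \<omega>) + \<alpha> \<noteq> 0"
    by eventually_elim (auto simp: complex_eq_iff)
qed auto

lemma integrable_prod_log_weight:
  fixes \<alpha> :: complex
  assumes "1 \<le> n"
  shows "integrable M (\<lambda>\<omega>. \<Prod>j\<in>{1..n}. log_weight (1 + norm (of_real (X j \<omega>) + \<alpha>)))"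
proof -
  interpret C: prob_space "cauchy_measure \<gamma>" by (rule prob_space_cauchy_measure)
  interpret P: product_sigma_finite "\<lambda>_::nat. cauchy_measure \<gamma>"
    by unfold_locales
  let ?f = "\<lambda>x. \<Prod>j\<in>{1..n}. log_weight (1 + norm (of_real (x j) + \<alpha>))"
  have "integrable (cauchy_measure \<gamma>) (\<lambda>x. log_weight (1 + norm (of_real x + \<alpha>)))"
    using integrable_cauchy_log_weight[OF \<gamma>, of \<alpha>] \<gamma> by (subst integrable_cauchy_measure_iff) auto
  then have "integrable (Pi\<^sub>M {1..n} (\<lambda>_. cauchy_measure \<gamma>)) ?f"
    by (intro P.product_integrable_prod) auto
  then have "integrable (distr M (Pi\<^sub>M {1..n} (\<lambda>_. borel)) (\<lambda>\<omega>. \<lambda>j\<in>{1..n}. X j \<omega>)) ?f"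
    unfolding distr_sample[OF assms] .
  then have "integrable M (\<lambda>\<omega>. ?f (\<lambda>j\<in>{1..n}. X j \<omega>))"
    by (rule integrable_distr[rotated]) (auto intro!: measurable_restrict X_measurable)
  moreover have "?f (\<lambda>j\<in>{1..n}. X j \<omega>) = ?f (\<lambda>j. X j \<omega>)" for \<omega>
    by (intro prod.cong) auto
  ultimately show ?thesis
    by (simp only:)
qed

lemma defect_measurable:
  "(\<lambda>\<omega>. power_sum_defect p {1..n} (\<lambda>j. of_real (X j \<omega>) + \<alpha>)) \<in> borel_measurable M"
  by (intro power_sum_defect_measurable borel_measurable_add borel_measurable_const
      measurable_compose[OF X_measurable] borel_measurable_of_real) auto

lemma integrable_defect:
  assumes n: "1 \<le> n" and p: "0 < p" "p < 1" and \<alpha>: "0 \<le> Im \<alpha>"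
  shows "integrable M (\<lambda>\<omega>. power_sum_defect p {1..n} (\<lambda>j. of_real (X j \<omega>) + \<alpha>))"
proof -
  have "{1..n} \<noteq> {}" using n by simp
  from power_sum_defect_dominated[OF finite_atLeastAtMost this p] obtain C where
    C: "\<And>z. (\<And>i. i \<in> {1..n} \<Longrightarrow> 0 \<le> Im (z i)) \<Longrightarrow>
      norm (power_sum_defect p {1..n} z) \<le> C * (\<Prod>i\<in>{1..n}. log_weight (1 + norm (z i)))"
    by blast
  show ?thesis
  proof (rule Bochner_Integration.integrable_bound)
    show "integrable M (\<lambda>\<omega>. C * (\<Prod>j\<in>{1..n}. log_weight (1 + norm (of_real (X j \<omega>) + \<alpha>))))"
      by (intro integrable_mult_right integrable_prod_log_weight n)
    show "AE \<omega> in M. norm (power_sum_defect p {1..n} (\<lambda>j. of_real (X j \<omega>) + \<alpha>))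
        \<le> norm (C * (\<Prod>j\<in>{1..n}. log_weight (1 + norm (of_real (X j \<omega>) + \<alpha>))))"
      unfolding real_norm_def using \<alpha> by (intro AE_I2 order_trans[OF C abs_ge_self]) simp
  qed (rule defect_measurable)
qed

text \<open>
  The defect is a function of the sample, whose law is a product of Cauchy laws, so the
  expectation is the value of the defect with every variable equal to \<open>\<gamma>\<close>.
\<close>
lemma expectation_defect:
  assumes n: "1 \<le> n" and p: "0 < p" "p < 1" and \<alpha>: "0 \<le> Im \<alpha>"
  shows "(\<integral>\<omega>. power_sum_defect p {1..n} (\<lambda>j. of_real (X j \<omega>) + \<alpha>) \<partial>M)
    = of_real (real n powr (1 / p) - real n) * (\<gamma> + \<alpha>)"
proof -
  define F where "F = (\<lambda>w. power_sum_defect p {1..n} (\<lambda>j. w j + \<alpha>))"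
  define \<kappa> where "\<kappa> = (\<lambda>r::real. (1 + norm \<alpha>) * log_weight (1 + r))"
  have "{1..n} \<noteq> {}" using n by simp
  from power_sum_defect_dominated[OF finite_atLeastAtMost this p] obtain C where
    C: "\<And>z. (\<And>i. i \<in> {1..n} \<Longrightarrow> 0 \<le> Im (z i)) \<Longrightarrow>
      norm (power_sum_defect p {1..n} z) \<le> C * (\<Prod>i\<in>{1..n}. log_weight (1 + norm (z i)))"
    by blast
  have meas: "(\<lambda>x. F (partly_real \<gamma> J x)) \<in> borel_measurable (Pi\<^sub>M J (\<lambda>_. borel))" for J
    unfolding F_def
  proof (intro power_sum_defect_measurable borel_measurable_add borel_measurable_const)
    fix i show "(\<lambda>x. partly_real \<gamma> J x i) \<in> borel_measurable (Pi\<^sub>M J (\<lambda>_. borel))"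
      unfolding partly_real_def by (cases "i \<in> J") auto
  qed
  have "(\<integral>x. F (partly_real \<gamma> {1..n} x) \<partial>Pi\<^sub>M {1..n} (\<lambda>_. cauchy_measure \<gamma>)) = F (\<lambda>_. \<gamma>)"
  proof (rule Poisson_product[OF \<gamma> prob_space_cauchy_measure finite_atLeastAtMost])
    fix w :: "nat \<Rightarrow> complex" and i
    assume "i \<in> {1..n}" and w: "\<And>j. j \<in> {1..n} \<Longrightarrow> 0 \<le> Im (w j)"
    then show "continuous_on {z. 0 \<le> Im z} (\<lambda>\<zeta>. F (w(i := \<zeta>)))"
        and "(\<lambda>\<zeta>. F (w(i := \<zeta>))) holomorphic_on {z. 0 < Im z}"
      unfolding F_def by (intro power_sum_defect_slice \<alpha> p; simp)+
  next
    fix w :: "nat \<Rightarrow> complex"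
    assume w: "\<And>j. j \<in> {1..n} \<Longrightarrow> 0 \<le> Im (w j)"
    have "norm (F w) \<le> C * (\<Prod>i\<in>{1..n}. log_weight (1 + norm (w i + \<alpha>)))"
      unfolding F_def using w \<alpha> by (intro C) auto
    also have "\<dots> \<le> \<bar>C\<bar> * (\<Prod>i\<in>{1..n}. \<kappa> (norm (w i)))"
      unfolding \<kappa>_def
      by (intro mult_mono abs_ge_self prod_mono conjI log_weight_norm_add_le prod_nonneg)
        (auto intro: order_trans[OF zero_le_one log_weight_ge_1])
    finally show "norm (F w) \<le> \<bar>C\<bar> * (\<Prod>i\<in>{1..n}. \<kappa> (norm (w i)))" .
  next
    have "((\<lambda>R. (1 + norm \<alpha>) * (log_weight (1 + R) / R)) \<longlongrightarrow> (1 + norm \<alpha>) * 0) at_top"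
      by (intro tendsto_intros log_weight_sublinear)
    then show "((\<lambda>R. \<kappa> R / R) \<longlongrightarrow> 0) at_top"
      by (simp add: \<kappa>_def)
    have "integrable (cauchy_measure \<gamma>) (\<lambda>x. log_weight (1 + \<bar>x\<bar>))"
      using integrable_cauchy_log_weight[OF \<gamma>, of 0] \<gamma> by (subst integrable_cauchy_measure_iff) auto
    then show "integrable (cauchy_measure \<gamma>) (\<lambda>x. \<kappa> \<bar>x\<bar>)"
      unfolding \<kappa>_def by (rule integrable_mult_right)
  qed (use meas in auto)
  then have "(\<integral>x. F (partly_real \<gamma> {1..n} x) \<partial>distr M (Pi\<^sub>M {1..n} (\<lambda>_. borel)) (\<lambda>\<omega>. \<lambda>j\<in>{1..n}. X j \<omega>))
      = F (\<lambda>_. \<gamma>)"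
    unfolding distr_sample[OF n] .
  then have "(\<integral>\<omega>. F (partly_real \<gamma> {1..n} (\<lambda>j\<in>{1..n}. X j \<omega>)) \<partial>M) = F (\<lambda>_. \<gamma>)"
    by (subst (asm) integral_distr) (auto intro!: measurable_restrict X_measurable meas)
  moreover have "F (partly_real \<gamma> {1..n} (\<lambda>j\<in>{1..n}. X j \<omega>))
      = power_sum_defect p {1..n} (\<lambda>j. of_real (X j \<omega>) + \<alpha>)" for \<omega>
    unfolding F_def by (intro power_sum_defect_cong) (simp add: partly_real_def)
  moreover have "F (\<lambda>_. \<gamma>) = of_real (real n powr (1 / p) - real n) * (\<gamma> + \<alpha>)"
    unfolding F_def using \<gamma> \<alpha> p n by (subst power_sum_defect_const) auto
  ultimately show ?thesis
    by simp
qed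

lemma expectation_power_arith_ratio:
  assumes n: "2 \<le> n" and p: "0 < p" "p < 1" and \<alpha>: "0 \<le> Im \<alpha>"
  shows "integrable M (\<lambda>\<omega>. of_real (real n powr (1 / p)) * power_mean \<alpha> p n (\<lambda>j. X j \<omega>)
      - of_nat n * arith_mean n (\<lambda>j. X j \<omega>))"
    and "(\<integral>\<omega>. (of_real (real n powr (1 / p)) * power_mean \<alpha> p n (\<lambda>j. X j \<omega>)
      - of_nat n * arith_mean n (\<lambda>j. X j \<omega>)) / of_real (real n powr (1 / p) - real n) \<partial>M) = \<gamma>"
proof -
  have n1: "1 \<le> n" using n by simp
  let ?N = "complex_of_real (real n powr (1 / p) - real n)"
  have N: "?N \<noteq> 0"
    using real_powr_inverse_gt[OF n p] by (simp only: of_real_eq_0_iff)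
  note eq = power_arith_difference_eq[OF n1 p(1)]
  show "integrable M (\<lambda>\<omega>. of_real (real n powr (1 / p)) * power_mean \<alpha> p n (\<lambda>j. X j \<omega>)
      - of_nat n * arith_mean n (\<lambda>j. X j \<omega>))"
    unfolding eq by (intro Bochner_Integration.integrable_diff integrable_defect n1 p \<alpha> integrable_const)
  have "(\<integral>\<omega>. power_sum_defect p {1..n} (\<lambda>j. of_real (X j \<omega>) + \<alpha>) - ?N * \<alpha> \<partial>M) = ?N * \<gamma>"
    using integrable_defect[OF n1 p \<alpha>] expectation_defect[OF n1 p \<alpha>]
    by (simp add: Bochner_Integration.integral_diff prob_space distrib_left del: of_real_diff)
  then show "(\<integral>\<omega>. (of_real (real n powr (1 / p)) * power_mean \<alpha> p n (\<lambda>j. X j \<omega>)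
      - of_nat n * arith_mean n (\<lambda>j. X j \<omega>)) / ?N \<partial>M) = \<gamma>"
    unfolding eq integral_divide_zero using N by simp
qed

lemma AE_power_arith_ratio_tendsto:
  assumes n: "2 \<le> n"
  shows "AE \<omega> in M. ((\<lambda>p::real. (of_real (real n powr (1 / p)) * power_mean \<alpha> p n (\<lambda>j. X j \<omega>)
      - of_nat n * arith_mean n (\<lambda>j. X j \<omega>)) / of_real (real n powr (1 / p) - real n))
    \<longlongrightarrow> geom_mean \<alpha> n (\<lambda>j. X j \<omega>)) (at_right 0)"
  using AE_X_add_nonzero[of n \<alpha>]
  by eventually_elim (intro power_arith_ratio_tendsto_geom_mean n, blast)

text \<open>
  For \<open>p < 1/2\<close> one has \<open>n powr (1 / p) \<ge> n\<^sup>2 \<ge> 2 n\<close>, so the denominator is at least half of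
  \<open>n powr (1 / p)\<close> and the uniform bound for the defect carries over to the ratio.
\<close>
lemma power_arith_ratio_tendsto_L1:
  assumes n: "2 \<le> n" and \<alpha>: "0 \<le> Im \<alpha>"
  shows "tendsto_L1 M
    (\<lambda>(p::real) \<omega>. (of_real (real n powr (1 / p)) * power_mean \<alpha> p n (\<lambda>j. X j \<omega>)
      - of_nat n * arith_mean n (\<lambda>j. X j \<omega>)) / of_real (real n powr (1 / p) - real n))
    (\<lambda>\<omega>. geom_mean \<alpha> n (\<lambda>j. X j \<omega>)) (at_right 0)"
proof -
  define W where "W = (\<lambda>\<omega>. \<Prod>j\<in>{1..n}. log_weight (1 + norm (of_real (X j \<omega>) + \<alpha>)))"
  define C where "C = 512 * (real n + 1)"
  have meas: "X j \<in> borel_measurable M" if "j \<in> {1..n}" for j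
    using that by (intro X_measurable) simp
  note [measurable] = meas
  have bound: "\<forall>\<^sub>F p in at_right 0. \<forall>\<omega>. norm ((of_real (real n powr (1 / p)) * power_mean \<alpha> p n (\<lambda>j. X j \<omega>)
      - of_nat n * arith_mean n (\<lambda>j. X j \<omega>)) / of_real (real n powr (1 / p) - real n)) \<le> C * W \<omega> + norm \<alpha>"
  proof -
    have "\<forall>\<^sub>F p in at_right (0::real). p \<in> {0<..<1 / 2}"
      by (rule eventually_at_right_real) simp
    moreover have "2 \<le> card {1..n}" using n by simp
    note power_sum_defect_uniformly_dominated[OF finite_atLeastAtMost this]
    ultimately show ?thesis
    proof eventually_elim
      case (elim p)
      then have p: "0 < p" "p < 1 / 2" by auto
      define N where "N = real n powr (1 / p)"
      have "real n powr 2 \<le> N"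
        unfolding N_def using p n by (intro powr_mono) (auto simp: field_simps)
      then have 1: "real n * real n \<le> N"
        using n by (simp add: power2_eq_square)
      have "2 * real n \<le> real n * real n"
        using n by (intro mult_right_mono) auto
      then have "2 * real n \<le> N"
        using 1 by (rule order_trans)
      then have N: "N \<le> 2 * (N - real n)" and N_pos: "0 < N - real n"
        using n by auto
      show ?case
      proof
        fix \<omega>
        define D where "D = power_sum_defect p {1..n} (\<lambda>j. of_real (X j \<omega>) + \<alpha>)"
        have W: "0 \<le> W \<omega>"
          unfolding W_def by (intro prod_nonneg) (auto intro: order_trans[OF zero_le_one log_weight_ge_1])
        have "norm D \<le> 256 * (real n + 1) * N * W \<omega>"
          using elim(2)[rule_format, of "\<lambda>j. of_real (X j \<omega>) + \<alpha>"] \<alpha> by (simp add: D_def W_def N_def)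
        also have "\<dots> \<le> 256 * (real n + 1) * (2 * (N - real n)) * W \<omega>"
          using N W by (intro mult_right_mono mult_left_mono) auto
        also have "\<dots> = C * W \<omega> * (N - real n)"
          by (simp add: C_def algebra_simps)
        finally have D: "norm D / (N - real n) \<le> C * W \<omega>"
          using N_pos by (simp add: pos_divide_le_eq)
        have "of_real (N - real n) \<noteq> (0::complex)"
          using N_pos by (simp only: of_real_eq_0_iff)
        then have "(of_real N * power_mean \<alpha> p n (\<lambda>j. X j \<omega>)
            - of_nat n * arith_mean n (\<lambda>j. X j \<omega>)) / of_real (N - real n) = D / of_real (N - real n) - \<alpha>"
          unfolding N_def D_def using n p
          by (subst power_arith_difference_eq) (auto simp: diff_divide_distrib)
        then show "norm ((of_real (real n powr (1 / p)) * power_mean \<alpha> p n (\<lambda>j. X j \<omega>)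
            - of_nat n * arith_mean n (\<lambda>j. X j \<omega>)) / of_real (real n powr (1 / p) - real n)) \<le> C * W \<omega> + norm \<alpha>"
          using norm_triangle_ineq4[of "D / of_real (N - real n)" \<alpha>] D N_pos
          unfolding N_def[symmetric] by (simp add: norm_divide del: of_real_diff)
      qed
    qed
  qed
  show ?thesis
  proof (rule dominated_tendsto_L1_at_right_0[OF _ _ _ bound AE_power_arith_ratio_tendsto[OF n]])
    show "integrable M (\<lambda>\<omega>. C * W \<omega> + norm \<alpha>)"
      unfolding W_def using n
      by (intro Bochner_Integration.integrable_add integrable_mult_right integrable_prod_log_weight integrable_const) auto
  qed (unfold power_mean_def arith_mean_def geom_mean_def, measurable)
qed

end

theorem corollary7p7:
  fixes M :: "'a measure" and X :: "nat \<Rightarrow> 'a \<Rightarrow> real" and \<gamma> :: complex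
  assumes "prob_space M"
    and "Im \<gamma> > 0"
    and "iid_cauchy M X \<gamma>"
  shows
    "(\<forall>(n::nat) (p::real) (\<alpha>::complex). n \<ge> 2 \<and> 0 < p \<and> p < 1 \<and> Im \<alpha> \<ge> 0 \<longrightarrow>
        integrable M (\<lambda>\<omega>. of_real (real n powr (1 / p)) * power_mean \<alpha> p n (\<lambda>j. X j \<omega>)
                           - of_nat n * arith_mean n (\<lambda>j. X j \<omega>)) \<and>
        (\<integral>\<omega>. (of_real (real n powr (1 / p)) * power_mean \<alpha> p n (\<lambda>j. X j \<omega>)
                - of_nat n * arith_mean n (\<lambda>j. X j \<omega>))
              / of_real (real n powr (1 / p) - real n) \<partial>M) = \<gamma>)
     \<and>
     (\<forall>(n::nat) (\<alpha>::complex). n \<ge> 2 \<and> Im \<alpha> \<ge> 0 \<longrightarrow>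
        (AE \<omega> in M.
          ((\<lambda>p::real. (of_real (real n powr (1 / p)) * power_mean \<alpha> p n (\<lambda>j. X j \<omega>)
                        - of_nat n * arith_mean n (\<lambda>j. X j \<omega>))
                      / of_real (real n powr (1 / p) - real n))
           \<longlongrightarrow> geom_mean \<alpha> n (\<lambda>j. X j \<omega>)) (at_right 0)) \<and>
        tendsto_L1 M
          (\<lambda>(p::real) \<omega>. (of_real (real n powr (1 / p)) * power_mean \<alpha> p n (\<lambda>j. X j \<omega>)
                           - of_nat n * arith_mean n (\<lambda>j. X j \<omega>))
                         / of_real (real n powr (1 / p) - real n))
          (\<lambda>\<omega>. geom_mean \<alpha> n (\<lambda>j. X j \<omega>))
          (at_right 0))"
proof -
  interpret prob_space M by (rule assms(1))
  interpret cauchy_sample M X \<gamma>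
    by unfold_locales (rule assms)+
  show ?thesis
    using expectation_power_arith_ratio AE_power_arith_ratio_tendsto power_arith_ratio_tendsto_L1
    by blast
qed

end
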